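(* Let $A\cong\mathbb{Z}^n$ with $n\ge1$, let $\varphi\colon A\to A$ be a monomorphism, and let $G=\langle A,t\mid tat^{-1}=\varphi(a),\ a\in A\rangle$ be the corresponding ascending HNN extension. Let $f_\varphi(x)\in\mathbb{Z}[x]$ be the characteristic polynomial of $\varphi$ (i.e. of the integer matrix representing $\varphi$ in a basis of $A$), and let $f_\varphi(x)=f_1(x)f_2(x)\cdots f_l(x)$ be its factorization into monic integer polynomials $f_i(x)$ that are irreducible over $\mathbb{Q}$ (listed with multiplicity). Let $n_i$ be the degree of $f_i(x)$. The following are equivalent: (1) $G$ is cyclic subgroup separable. (2) There is no prime $p$ and index $1\le i\le l$ such that $f_i(x)\equiv x^{n_i}\pmod p$.
   Context: A subgroup $H$ of a group $G$ is separable in $G$ if $H$ is an intersection of finite-index subgroups of $G$ (equivalently, $H$ is closed in the profinite topology on $G$). A group is cyclic subgroup separable if every cyclic subgroup is separable. *)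

theory Defs
  imports
    "HOL-Algebra.Product_Groups"
    "HOL-Number_Theory.Cong"
    "Jordan_Normal_Form.Char_Poly"
begin

section \<open>Groups given by generators and relators\<close>

text \<open>A letter \<open>(x, True)\<close> stands for the generator \<open>x\<close>, and \<open>(x, False)\<close> for its formal inverse.\<close>

type_synonym 'x word = "('x \<times> bool) list"

definition words :: "'x set \<Rightarrow> 'x word set"
  where "words X = lists (X \<times> UNIV)"

text \<open>Two words over \<open>X\<close> represent the same element of \<open>\<langle>X | R\<rangle>\<close> iff one can be transformed into
  the other by inserting and deleting subwords \<open>x x\<inverse>\<close>, \<open>x\<inverse> x\<close> and \<open>r \<in> R\<close>.\<close>

inductive word_eq :: "'x set \<Rightarrow> 'x word set \<Rightarrow> 'x word \<Rightarrow> 'x word \<Rightarrow> bool"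
  for X :: "'x set" and R :: "'x word set"
  where
    refl: "u \<in> words X \<Longrightarrow> word_eq X R u u"
  | sym: "word_eq X R u v \<Longrightarrow> word_eq X R v u"
  | trans: "word_eq X R u v \<Longrightarrow> word_eq X R v w \<Longrightarrow> word_eq X R u w"
  | cancel: "u \<in> words X \<Longrightarrow> v \<in> words X \<Longrightarrow> x \<in> X
      \<Longrightarrow> word_eq X R (u @ [(x, e), (x, \<not> e)] @ v) (u @ v)"
  | relator: "u \<in> words X \<Longrightarrow> v \<in> words X \<Longrightarrow> r \<in> R \<Longrightarrow> r \<in> words X
      \<Longrightarrow> word_eq X R (u @ r @ v) (u @ v)"

definition word_rel :: "'x set \<Rightarrow> 'x word set \<Rightarrow> ('x word \<times> 'x word) set"
  where "word_rel X R = {(u, v). word_eq X R u v}"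

definition presented_group :: "'x set \<Rightarrow> 'x word set \<Rightarrow> 'x word set monoid"
  where "presented_group X R =
    \<lparr>carrier = words X // word_rel X R,
     monoid.mult = (\<lambda>P Q. \<Union>p\<in>P. \<Union>q\<in>Q. word_rel X R `` {p @ q}),
     one = word_rel X R `` {[]}\<rparr>"

lemma words_append [simp]: "u @ v \<in> words X \<longleftrightarrow> u \<in> words X \<and> v \<in> words X"
  by (auto simp: words_def)

lemma word_eq_words: "word_eq X R u v \<Longrightarrow> u \<in> words X \<and> v \<in> words X"
  by (induction rule: word_eq.induct) (auto simp: words_def)

lemma word_eq_context:
  assumes "word_eq X R u v" "a \<in> words X" "b \<in> words X"
  shows "word_eq X R (a @ u @ b) (a @ v @ b)"
  using assms
proof (induction rule: word_eq.induct)
  case (cancel u v x e)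
  then show ?case using word_eq.cancel[of "a @ u" X "v @ b" x R e] by simp
next
  case (relator u v r)
  then show ?case using word_eq.relator[of "a @ u" X "v @ b" r R] by simp
next
  case (refl u)
  then show ?case by (intro word_eq.refl) simp
next
  case (sym u v)
  then show ?case by (blast intro: word_eq.sym)
next
  case (trans u v w)
  then show ?case by (blast intro: word_eq.trans)
qed

lemma word_eq_append:
  assumes "word_eq X R u u'" "word_eq X R v v'"
  shows "word_eq X R (u @ v) (u' @ v')"
proof -
  have nil: "[] \<in> words X" by (simp add: words_def)
  have "u' \<in> words X" "v \<in> words X"
    using word_eq_words[OF assms(1)] word_eq_words[OF assms(2)] by simp_all
  then have "word_eq X R ([] @ u @ v) ([] @ u' @ v)" "word_eq X R (u' @ v @ []) (u' @ v' @ [])"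
    using nil assms by (blast intro: word_eq_context)+
  then show ?thesis using word_eq.trans[of X R "u @ v" "u' @ v" "u' @ v'"] by simp
qed

lemma equiv_word_rel: "equiv (words X) (word_rel X R)"
proof (rule equivI)
  show "word_rel X R \<subseteq> words X \<times> words X"
    using word_eq_words[of X R] by (auto simp: word_rel_def)
  show "refl_on (words X) (word_rel X R)"
    by (simp add: word_rel_def refl_on_def word_eq.refl)
  show "sym (word_rel X R)"
    unfolding word_rel_def sym_def using word_eq.sym[of X R] by blast
  show "trans (word_rel X R)"
    unfolding word_rel_def trans_def using word_eq.trans[of X R] by blast
qed

lemma presented_group_mult:
  assumes "u \<in> words X" "v \<in> words X"
  shows "(word_rel X R `` {u}) \<otimes>\<^bsub>presented_group X R\<^esub> (word_rel X R `` {v})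
    = word_rel X R `` {u @ v}"
proof -
  have "congruent2 (word_rel X R) (word_rel X R) (\<lambda>p q. word_rel X R `` {p @ q})"
    unfolding congruent2_def
    by (auto intro!: equiv_class_eq[OF equiv_word_rel]) (simp add: word_rel_def word_eq_append)
  then show ?thesis
    using UN_equiv_class2[OF equiv_word_rel equiv_word_rel] assms
    by (simp add: presented_group_def)
qed

lemma word_inverse:
  assumes "u \<in> words X"
  shows "\<exists>v \<in> words X. word_eq X R (v @ u) []"
  using assms
proof (induction u)
  case Nil
  then show ?case by (auto simp: words_def intro!: bexI[of _ "[]"] word_eq.refl)
next
  case (Cons l u)
  obtain x e where l: "l = (x, e)" by force
  have x: "x \<in> X" and u: "u \<in> words X" using Cons.prems by (auto simp: l words_def)
  obtain v where v: "v \<in> words X" "word_eq X R (v @ u) []" using Cons.IH u by blast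
  have "word_eq X R (v @ [(x, \<not> e), (x, \<not> \<not> e)] @ u) (v @ u)"
    using v(1) u x by (rule word_eq.cancel)
  then have "word_eq X R ((v @ [(x, \<not> e)]) @ l # u) []"
    using word_eq.trans[OF _ v(2)] by (simp add: l)
  moreover have "v @ [(x, \<not> e)] \<in> words X" using v(1) x by (auto simp: words_def)
  ultimately show ?case by blast
qed

lemma group_presented_group: "group (presented_group X R)"
proof -
  have nil: "[] \<in> words X" by (simp add: words_def)
  have carrier: "P \<in> carrier (presented_group X R) \<longleftrightarrow> (\<exists>u\<in>words X. P = word_rel X R `` {u})"
    for P by (auto simp: presented_group_def quotient_def)
  have one: "\<one>\<^bsub>presented_group X R\<^esub> = word_rel X R `` {[]}"
    by (simp add: presented_group_def)
  show ?thesis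
  proof (rule groupI)
    fix P assume "P \<in> carrier (presented_group X R)"
    then obtain u where u: "u \<in> words X" "P = word_rel X R `` {u}" using carrier by blast
    obtain v where v: "v \<in> words X" "word_eq X R (v @ u) []" using word_inverse u(1) by blast
    have "word_rel X R `` {v @ u} = word_rel X R `` {[]}"
      using v(2) by (intro equiv_class_eq[OF equiv_word_rel]) (simp add: word_rel_def)
    then show "\<exists>Q\<in>carrier (presented_group X R).
        Q \<otimes>\<^bsub>presented_group X R\<^esub> P = \<one>\<^bsub>presented_group X R\<^esub>"
      using u v(1) carrier one presented_group_mult by metis
    show "\<one>\<^bsub>presented_group X R\<^esub> \<otimes>\<^bsub>presented_group X R\<^esub> P = P"
      using u nil by (simp add: one presented_group_mult)
  next
    show "\<one>\<^bsub>presented_group X R\<^esub> \<in> carrier (presented_group X R)"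
      unfolding carrier one using nil by blast
  next
    fix P Q
    assume "P \<in> carrier (presented_group X R)" "Q \<in> carrier (presented_group X R)"
    then obtain u v where uv: "u \<in> words X" "P = word_rel X R `` {u}"
      "v \<in> words X" "Q = word_rel X R `` {v}" unfolding carrier by auto
    then show "P \<otimes>\<^bsub>presented_group X R\<^esub> Q \<in> carrier (presented_group X R)"
      unfolding carrier by (intro bexI[of _ "u @ v"]) (simp_all add: presented_group_mult)
  next
    fix P Q S
    assume "P \<in> carrier (presented_group X R)" "Q \<in> carrier (presented_group X R)"
      "S \<in> carrier (presented_group X R)"
    then obtain u v w where "u \<in> words X" "P = word_rel X R `` {u}"
      "v \<in> words X" "Q = word_rel X R `` {v}" "w \<in> words X" "S = word_rel X R `` {w}"
      unfolding carrier by auto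
    then show "P \<otimes>\<^bsub>presented_group X R\<^esub> Q \<otimes>\<^bsub>presented_group X R\<^esub> S
        = P \<otimes>\<^bsub>presented_group X R\<^esub> (Q \<otimes>\<^bsub>presented_group X R\<^esub> S)"
      by (simp add: presented_group_mult)
  qed
qed


section \<open>Ascending HNN extensions\<close>

text \<open>The presentation \<open>\<langle>A, t | t a t\<inverse> = \<phi> a, a \<in> A\<rangle>\<close>: the generators are the elements of \<open>A\<close>
  (injected by \<open>Inl\<close>) together with \<open>t = Inr ()\<close>, and the relators comprise the multiplication
  table of \<open>A\<close>, each word being \<open>a b (ab)\<inverse>\<close>, and the words \<open>t a t\<inverse> (\<phi> a)\<inverse>\<close>.\<close>

definition hnn_relators :: "('a, 'm) monoid_scheme \<Rightarrow> ('a \<Rightarrow> 'a) \<Rightarrow> ('a + unit) word set"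
  where "hnn_relators A \<phi> =
    {[(Inl a, True), (Inl b, True), (Inl (a \<otimes>\<^bsub>A\<^esub> b), False)] | a b.
       a \<in> carrier A \<and> b \<in> carrier A} \<union>
    {[(Inr (), True), (Inl a, True), (Inr (), False), (Inl (\<phi> a), False)] | a. a \<in> carrier A}"

definition ascending_hnn :: "('a, 'm) monoid_scheme \<Rightarrow> ('a \<Rightarrow> 'a) \<Rightarrow> ('a + unit) word set monoid"
  where "ascending_hnn A \<phi> = presented_group (carrier A <+> {()}) (hnn_relators A \<phi>)"

lemma group_ascending_hnn: "group (ascending_hnn A \<phi>)"
  by (simp add: ascending_hnn_def group_presented_group)


section \<open>Separability\<close>

definition separable :: "('a, 'm) monoid_scheme \<Rightarrow> 'a set \<Rightarrow> bool"
  where "separable G H \<longleftrightarrow>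
    (\<exists>\<K>. \<K> \<noteq> {} \<and> (\<forall>K\<in>\<K>. subgroup K G \<and> finite (rcosets\<^bsub>G\<^esub> K)) \<and> H = \<Inter>\<K>)"

definition cyclic_subgroup_separable :: "('a, 'm) monoid_scheme \<Rightarrow> bool"
  where "cyclic_subgroup_separable G \<longleftrightarrow> (\<forall>g\<in>carrier G. separable G (generate G {g}))"


section \<open>Free abelian groups of finite rank and matrices of endomorphisms\<close>

definition Z_power :: "nat \<Rightarrow> (nat \<Rightarrow> int) monoid"
  where "Z_power n = product_group {..<n} (\<lambda>_. integer_group)"

definition Z_basis :: "('a, 'm) monoid_scheme \<Rightarrow> nat \<Rightarrow> (nat \<Rightarrow> 'a) \<Rightarrow> bool"
  where "Z_basis A n b \<longleftrightarrow>
    (\<forall>i<n. b i \<in> carrier A) \<and>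
    (\<forall>a\<in>carrier A. \<exists>!c. c \<in> carrier (Z_power n) \<and>
       a = (\<Otimes>\<^bsub>A\<^esub> i\<in>{..<n}. b i [^]\<^bsub>A\<^esub> (c i :: int)))"

text \<open>Coordinates are column vectors: column \<open>j\<close> of \<open>M\<close> lists the coordinates of \<open>\<phi> (b j)\<close>.\<close>

definition represents ::
    "('a, 'm) monoid_scheme \<Rightarrow> nat \<Rightarrow> (nat \<Rightarrow> 'a) \<Rightarrow> ('a \<Rightarrow> 'a) \<Rightarrow> int mat \<Rightarrow> bool"
  where "represents A n b \<phi> M \<longleftrightarrow>
    M \<in> carrier_mat n n \<and>
    (\<forall>j<n. \<phi> (b j) = (\<Otimes>\<^bsub>A\<^esub> i\<in>{..<n}. b i [^]\<^bsub>A\<^esub> (M $$ (i, j))))"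


section \<open>Congruence of integer polynomials\<close>

definition poly_cong :: "int poly \<Rightarrow> int poly \<Rightarrow> nat \<Rightarrow> bool"
  where "poly_cong f g p \<longleftrightarrow> (\<forall>k. [coeff f k = coeff g k] (mod int p))"

end

theory Submission
  imports Defs "HOL-Algebra.Bij"
begin

text \<open>
  Let \<open>A\<^sub>\<infinity>\<close> be the normal closure of \<open>A\<close> in \<open>G\<close>, the direct limit of \<open>A\<close> along \<open>\<phi>\<close>, so that \<open>G\<close> is the
  semidirect product of \<open>A\<^sub>\<infinity>\<close> with \<open>\<langle>t\<rangle>\<close>. The point is that some \<open>f\<^sub>i\<close> is congruent to a power of \<open>x\<close>
  modulo \<open>p\<close> iff some \<open>u \<noteq> 0\<close> in \<open>A\<close> is divisible by all powers of \<open>p\<close> in \<open>A\<^sub>\<infinity>\<close>.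

  If \<open>f\<^sub>i = x\<^sup>d - p g\<close> and \<open>f\<^sub>i(\<phi>)\<close> kills \<open>u \<noteq> 0\<close>, then \<open>\<phi>\<^sup>d\<^sup>k u = p\<^sup>k g(\<phi>)\<^sup>k u\<close> is \<open>p\<^sup>k\<close> times an element of
  \<open>A\<close>. Such a \<open>u\<close> has order prime to \<open>p\<close> in every finite quotient, so \<open>u\<close> lies in the profinite closure
  of \<open>\<langle>p u\<rangle>\<close>. Conversely, if no such \<open>u\<close> exists, then \<open>\<langle>a\<rangle>\<close> is an intersection of subgroups
  \<open>\<langle>a\<rangle> + e A\<^sub>\<infinity>\<close> of \<open>A\<^sub>\<infinity>\<close>, each detected by the finite group of permutations of
  \<open>A\<^sub>\<infinity> / e A\<^sub>\<infinity>\<close> on which \<open>A\<close> acts by translations and \<open>t\<close> by \<open>\<phi>\<close>. An element of nonzero exponent sum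
  in \<open>t\<close> always generates a separable subgroup, because \<open>A\<^sub>\<infinity>\<close> is residually finite.
\<close>

section \<open>Polynomials in a matrix\<close>

text \<open>Horner's scheme. The size is read off \<open>dim_row M\<close> because the matrix type
  does not record it.\<close>

definition mat_poly :: "'a::comm_ring_1 mat \<Rightarrow> 'a poly \<Rightarrow> 'a mat"
  where "mat_poly M g =
    fold_coeffs (\<lambda>c W. c \<cdot>\<^sub>m 1\<^sub>m (dim_row M) + M * W) g (0\<^sub>m (dim_row M) (dim_row M))"

context
  fixes M :: "'a::comm_ring_1 mat" and n :: nat
  assumes M: "M \<in> carrier_mat n n"
begin

lemma mat_poly_0: "mat_poly M 0 = 0\<^sub>m n n"
  using M by (simp add: mat_poly_def)

lemma mat_poly_pCons: "mat_poly M (pCons c g) = c \<cdot>\<^sub>m 1\<^sub>m n + M * mat_poly M g"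
\<comment> \<open>\<open>pCons 0 0\<close> is \<open>0\<close>, whose coefficient list is empty, so
  \<open>fold_coeffs\<close> takes no Horner step there.\<close>
proof (cases "c = 0 \<and> g = 0")
  case True
  then show ?thesis using M by (auto simp: mat_poly_def)
next
  case False
  then show ?thesis using M
    by (cases "c = 0") (auto simp: mat_poly_def)
qed

lemma mat_poly_carrier [simp]: "mat_poly M g \<in> carrier_mat n n"
  by (induction g) (use M in \<open>auto simp: mat_poly_0 mat_poly_pCons\<close>)

lemma mat_poly_dim [simp]: "dim_row (mat_poly M g) = n" "dim_col (mat_poly M g) = n"
  using mat_poly_carrier[of g] by (auto simp del: mat_poly_carrier)

lemma mat_poly_1: "mat_poly M 1 = 1\<^sub>m n"
  unfolding one_pCons mat_poly_pCons mat_poly_0 using M by (intro eq_matI) auto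

lemma mat_poly_add: "mat_poly M (g + h) = mat_poly M g + mat_poly M h"
proof (induction g h rule: poly_induct2)
  case 0
  then show ?case by (simp add: mat_poly_0)
next
  case (pCons a g b h)
  have "M * (mat_poly M g + mat_poly M h) = M * mat_poly M g + M * mat_poly M h"
    using M by (intro mult_add_distrib_mat) auto
  then show ?case using M
    by (simp add: mat_poly_pCons pCons.IH) (rule eq_matI; auto simp: algebra_simps)
qed

lemma mat_poly_smult: "mat_poly M (Polynomial.smult c g) = c \<cdot>\<^sub>m mat_poly M g"
proof (induction g)
  case 0
  then show ?case by (auto simp: mat_poly_0)
next
  case (pCons a g)
  have "M * (c \<cdot>\<^sub>m mat_poly M g) = c \<cdot>\<^sub>m (M * mat_poly M g)"
    using M by (intro mult_smult_distrib) auto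
  then show ?case using M
    by (simp add: mat_poly_pCons pCons.IH) (rule eq_matI; auto simp: algebra_simps)
qed

lemma mat_poly_mult: "mat_poly M (g * h) = mat_poly M g * mat_poly M h"
proof (induction g)
  case 0
  then show ?case by (auto simp: mat_poly_0)
next
  case (pCons a g)
  have "mat_poly M (pCons a g * h) = a \<cdot>\<^sub>m mat_poly M h + M * (mat_poly M g * mat_poly M h)"
    using M by (simp add: mat_poly_add mat_poly_smult mat_poly_pCons pCons.IH)
      (rule eq_matI; auto)
  also have "M * (mat_poly M g * mat_poly M h) = M * mat_poly M g * mat_poly M h"
    using M by (intro assoc_mult_mat[symmetric]) auto
  also have "a \<cdot>\<^sub>m mat_poly M h = (a \<cdot>\<^sub>m 1\<^sub>m n) * mat_poly M h"
    by (subst mult_smult_assoc_mat[of _ n n _ n]) auto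
  also have "(a \<cdot>\<^sub>m 1\<^sub>m n) * mat_poly M h + M * mat_poly M g * mat_poly M h
      = (a \<cdot>\<^sub>m 1\<^sub>m n + M * mat_poly M g) * mat_poly M h"
    using M by (intro add_mult_distrib_mat[symmetric]) auto
  finally show ?case by (simp add: mat_poly_pCons)
qed

lemma mat_poly_X: "mat_poly M [:0, 1:] = M"
  using M by (simp add: mat_poly_pCons mat_poly_0) (rule eq_matI; auto)

lemma mat_poly_mult_vec:
  "v \<in> carrier_vec n \<Longrightarrow> mat_poly M (g * h) *\<^sub>v v = mat_poly M g *\<^sub>v (mat_poly M h *\<^sub>v v)"
  by (metis mat_poly_mult mat_poly_carrier assoc_mult_mat_vec)

lemma mat_poly_sum_index:
  "i < n \<Longrightarrow> j < n \<Longrightarrow> mat_poly M (\<Sum>k\<in>K. g k) $$ (i, j) = (\<Sum>k\<in>K. mat_poly M (g k) $$ (i, j))"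
  by (induction K rule: infinite_finite_induct) (auto simp: mat_poly_0 mat_poly_add)

text \<open>Over \<open>R[x]\<close>, the map sending a column \<open>p\<close> to the sum of the \<open>p\<^sub>i(M) e\<^sub>i\<close> kills the image of
  \<open>x 1 - M\<close>, which contains all \<open>\<chi> e\<^sub>j\<close> by the adjugate formula.\<close>

theorem cayley_hamilton: "mat_poly M (char_poly M) = 0\<^sub>m n n"
proof (rule eq_matI)
  fix r j assume "r < dim_row (0\<^sub>m n n)" "j < dim_col (0\<^sub>m n n)"
  then have r: "r < n" and j: "j < n" by auto
  let ?C = "char_poly_matrix M"
  define P where "P = adj_mat ?C"
  have C: "?C \<in> carrier_mat n n" using M by simp
  have P: "P \<in> carrier_mat n n" and CP: "?C * P = char_poly M \<cdot>\<^sub>m 1\<^sub>m n"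
    using adj_mat[OF C] by (simp_all add: P_def char_poly_def)
  have Cik: "?C $$ (i, k) = (if i = k then [:0, 1:] else 0) + [:- M $$ (i, k):]"
    if "i < n" "k < n" for i k
    using that M by (auto simp: char_poly_matrix_def)
  \<comment> \<open>\<open>p\<close> is column \<open>j\<close> of the adjugate of
    \<open>x 1 - M\<close>; only row \<open>r\<close> of each matrix \<open>mat_poly M (p k)\<close>
    is tracked.\<close>
  define p where "p k = P $$ (k, j)" for k
  define m where "m k i = mat_poly M (p k) $$ (r, i)" for k i
  have entry: "mat_poly M (?C $$ (i, k) * p k) $$ (r, i)
      = (if i = k then (\<Sum>s<n. m k s * M $$ (s, i)) else 0) - M $$ (i, k) * m k i"
    if i: "i < n" and k: "k < n" for i k
  proof -
    have 1: "mat_poly M ([:0, 1:] * p k) $$ (r, i) = (\<Sum>s<n. m k s * M $$ (s, i))"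
    proof -
      have "mat_poly M ([:0, 1:] * p k) = mat_poly M (p k) * M"
        by (metis mat_poly_mult mat_poly_X mult.commute)
      then show ?thesis using r i M
        by (auto simp: scalar_prod_def m_def lessThan_atLeast0 intro!: sum.cong)
    qed
    have 2: "mat_poly M ([:- M $$ (i, k):] * p k) $$ (r, i) = - (M $$ (i, k) * m k i)"
      using r i M mat_poly_smult[of "- M $$ (i, k)" "p k"] by (simp add: m_def)
    show ?thesis unfolding Cik[OF i k] distrib_right mat_poly_add
      using 1 2 r i by (cases "i = k") (auto simp: mat_poly_0)
  qed
  have "(\<Sum>i<n. mat_poly M ((?C * P) $$ (i, j)) $$ (r, i)) = mat_poly M (char_poly M) $$ (r, j)"
  proof -
    have "mat_poly M ((?C * P) $$ (i, j)) $$ (r, i)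
        = (if i = j then mat_poly M (char_poly M) $$ (r, j) else 0)" if "i < n" for i
      using that r j by (simp add: CP mat_poly_0)
    then show ?thesis using j by (simp add: sum.delta)
  qed
  moreover have "(\<Sum>i<n. mat_poly M ((?C * P) $$ (i, j)) $$ (r, i))
      = (\<Sum>i<n. \<Sum>k<n. mat_poly M (?C $$ (i, k) * p k) $$ (r, i))"
  proof (rule sum.cong[OF HOL.refl])
    fix i assume "i \<in> {..<n}"
    then have i: "i < n" by simp
    have "(?C * P) $$ (i, j) = (\<Sum>k<n. ?C $$ (i, k) * p k)"
      using i j C P by (auto simp: scalar_prod_def p_def lessThan_atLeast0 simp del: char_poly_matrix_closed)
    then show "mat_poly M ((?C * P) $$ (i, j)) $$ (r, i)
        = (\<Sum>k<n. mat_poly M (?C $$ (i, k) * p k) $$ (r, i))"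
      using mat_poly_sum_index[OF r i] by simp
  qed
  moreover have "\<dots> = (\<Sum>i<n. (\<Sum>s<n. m i s * M $$ (s, i))) - (\<Sum>i<n. \<Sum>k<n. M $$ (i, k) * m k i)"
    by (simp add: entry sum_subtractf sum.delta)
  \<comment> \<open>On evaluation the diagonal \<open>x\<close> multiplies
    \<open>mat_poly M (p i)\<close> by \<open>M\<close>. Summed over \<open>i\<close>, this cancels
    against the constant entries \<open>M $$ (i, k)\<close> once the two sums are exchanged.\<close>
  moreover have "(\<Sum>i<n. (\<Sum>s<n. m i s * M $$ (s, i))) = (\<Sum>i<n. \<Sum>k<n. M $$ (i, k) * m k i)"
    by (subst sum.swap) (simp add: mult.commute)
  ultimately show "mat_poly M (char_poly M) $$ (r, j) = 0\<^sub>m n n $$ (r, j)"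
    using r j by simp
qed auto

end

section \<open>Eigenvectors, and divisors of the characteristic polynomial\<close>

text \<open>Serves to pass from the integers to the complex numbers, where eigenvectors are
  available.\<close>

lemma (in comm_ring_hom) mat_poly_hom:
  assumes M: "M \<in> carrier_mat n n"
  shows "mat_poly (map_mat hom M) (map_poly hom g) = map_mat hom (mat_poly M g)"
proof (induction g)
  case 0
  show ?case using M by (simp add: mat_poly_0[of _ n]) (rule eq_matI; simp)
next
  case (pCons a g)
  have M': "map_mat hom M \<in> carrier_mat n n" using M by simp
  have "mat_poly (map_mat hom M) (map_poly hom (pCons a g))
      = hom a \<cdot>\<^sub>m 1\<^sub>m n + map_mat hom (M * mat_poly M g)"
    using M M' pCons.IH by (simp add: map_poly_pCons_hom mat_poly_pCons[OF M'] mat_hom_mult[OF M mat_poly_carrier[OF M]])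
  also have "\<dots> = map_mat hom (mat_poly M (pCons a g))"
    using M mat_poly_dim[OF M] by (simp add: mat_poly_pCons[OF M]) (rule eq_matI; auto simp: hom_distribs)
  finally show ?case .
qed

lemma mult_mat_vec_smult:
  "W \<in> carrier_mat m n \<Longrightarrow> v \<in> carrier_vec n \<Longrightarrow> W *\<^sub>v (c \<cdot>\<^sub>v v) = c \<cdot>\<^sub>v (W *\<^sub>v (v :: 'a::comm_semiring_0 vec))"
  by (intro eq_vecI) (auto simp: scalar_prod_def sum_distrib_left ac_simps intro!: sum.cong)

lemma mat_poly_eigenvector:
  assumes M: "M \<in> carrier_mat n n" and v: "v \<in> carrier_vec n" and ev: "M *\<^sub>v v = c \<cdot>\<^sub>v v"
  shows "mat_poly M g *\<^sub>v v = poly g c \<cdot>\<^sub>v v"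
proof (induction g)
  case 0
  then show ?case using v M by (auto simp: mat_poly_0)
next
  case (pCons a g)
  have "mat_poly M (pCons a g) *\<^sub>v v = (a \<cdot>\<^sub>m 1\<^sub>m n) *\<^sub>v v + (M * mat_poly M g) *\<^sub>v v"
    using M v by (simp add: mat_poly_pCons[OF M])
      (subst add_mult_distrib_mat_vec[of _ n n], auto intro: mult_carrier_mat[of _ n n])
  also have "(a \<cdot>\<^sub>m 1\<^sub>m n) *\<^sub>v v = a \<cdot>\<^sub>v v"
    using v by auto
  also have "(M * mat_poly M g) *\<^sub>v v = M *\<^sub>v (poly g c \<cdot>\<^sub>v v)"
    using assoc_mult_mat_vec[OF M mat_poly_carrier[OF M] v] pCons.IH by simp
  also have "\<dots> = (poly g c * c) \<cdot>\<^sub>v v"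
    using M v ev by (simp add: mult_mat_vec_smult[OF M v] smult_smult_assoc)
  also have "a \<cdot>\<^sub>v v + (poly g c * c) \<cdot>\<^sub>v v = poly (pCons a g) c \<cdot>\<^sub>v v"
    using v by (auto simp: algebra_simps)
  finally show ?case .
qed

text \<open>A complex root \<open>c\<close> of \<open>f\<close> is an eigenvalue of
  \<open>M\<close>, and \<open>f(M)\<close> kills its eigenvectors. So the determinant of
  \<open>f(M)\<close> vanishes over the complex numbers, hence over the integers, and an integer
  matrix of determinant zero kills a nonzero integer vector.\<close>

lemma divisor_char_poly_singular:
  fixes M :: "int mat"
  assumes M: "M \<in> carrier_mat n n" and f: "f dvd char_poly M" and deg: "degree f \<noteq> 0"
  shows "\<exists>u\<in>carrier_vec n. u \<noteq> 0\<^sub>v n \<and> mat_poly M f *\<^sub>v u = 0\<^sub>v n"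
proof -
  let ?h = "of_int :: int \<Rightarrow> complex"
  let ?C = "map_mat ?h M"
  have C: "?C \<in> carrier_mat n n" using M by simp
  have "degree (map_poly ?h f) \<noteq> 0" using deg by simp
  then have "\<not> constant (poly (map_poly ?h f))" by (simp add: constant_degree)
  then obtain c where c: "poly (map_poly ?h f) c = 0"
    using fundamental_theorem_of_algebra by blast
  have "map_poly ?h f dvd map_poly ?h (char_poly M)"
    using f by (auto elim!: dvdE simp: hom_distribs)
  then have "poly (char_poly ?C) c = 0"
    using c by (auto elim!: dvdE simp: of_int_hom.char_poly_hom[OF M])
  then obtain v where v: "v \<in> carrier_vec n" "v \<noteq> 0\<^sub>v n" "?C *\<^sub>v v = c \<cdot>\<^sub>v v"
    using C eigenvalue_root_char_poly[OF C] by (auto simp: eigenvalue_def eigenvector_def)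
  have "mat_poly ?C (map_poly ?h f) *\<^sub>v v = 0\<^sub>v n"
    using mat_poly_eigenvector[OF C v(1,3), of "map_poly ?h f"] v(1) c by auto
  then have "det (map_mat ?h (mat_poly M f)) = 0"
    using v det_0_iff_vec_prod_zero[of "map_mat ?h (mat_poly M f)" n] M mat_poly_carrier[OF M]
    by (auto simp: of_int_hom.mat_poly_hom[OF M])
  then have "det (mat_poly M f) = 0" by simp
  then show ?thesis using det_0_iff_vec_prod_zero[OF mat_poly_carrier[OF M]] by blast
qed

lemma smult_one_mat_mult_vec:
  "v \<in> carrier_vec n \<Longrightarrow> (c \<cdot>\<^sub>m 1\<^sub>m n) *\<^sub>v v = c \<cdot>\<^sub>v (v :: 'a::comm_semiring_1 vec)"
  by auto

lemma smult_vec_eq_0_iff: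
  fixes u :: "'a::idom vec"
  assumes "u \<in> carrier_vec n"
  shows "c \<cdot>\<^sub>v u = 0\<^sub>v n \<longleftrightarrow> c = 0 \<or> u = 0\<^sub>v n"
  using assms by (auto simp: vec_eq_iff)

section \<open>Divisibility in the direct limit\<close>

definition dvd_vec :: "int \<Rightarrow> int vec \<Rightarrow> bool"
  where "dvd_vec e v \<longleftrightarrow> (\<forall>i<dim_vec v. e dvd v $ i)"

lemma dvd_vec_mult_mat:
  assumes "W \<in> carrier_mat m n" "v \<in> carrier_vec n" "dvd_vec e v"
  shows "dvd_vec e (W *\<^sub>v v)"
  using assms by (auto simp: dvd_vec_def scalar_prod_def intro!: dvd_sum dvd_mult)

lemma dvd_vec_iff_smult:
  assumes v: "v \<in> carrier_vec n"
  shows "dvd_vec e v \<longleftrightarrow> (\<exists>w\<in>carrier_vec n. v = e \<cdot>\<^sub>v w)"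
proof
  assume "dvd_vec e v"
  then have "v = e \<cdot>\<^sub>v vec n (\<lambda>i. v $ i div e)"
    using v by (intro eq_vecI) (auto simp: dvd_vec_def)
  then show "\<exists>w\<in>carrier_vec n. v = e \<cdot>\<^sub>v w" by (meson vec_carrier)
qed (use v in \<open>auto simp: dvd_vec_def\<close>)

text \<open>\<open>u\<close> lies in \<open>e A\<^sub>\<infinity>\<close>, where \<open>A\<^sub>\<infinity>\<close> is the direct limit of \<open>A \<rightarrow> A \<rightarrow> \<dots>\<close> along \<open>M\<close>.\<close>

definition eventually_dvd :: "int mat \<Rightarrow> int \<Rightarrow> int vec \<Rightarrow> bool"
  where "eventually_dvd M e u \<longleftrightarrow> (\<exists>m. dvd_vec e (mat_poly M (monom 1 m) *\<^sub>v u))"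

context
  fixes M :: "int mat" and n :: nat
  assumes M: "M \<in> carrier_mat n n"
begin

text \<open>Polynomials in \<open>M\<close> commute with the powers of \<open>M\<close>. The lemma
  allows replacing \<open>u\<close> by a vector \<open>mat_poly M g *\<^sub>v u\<close> that a
  single factor of the characteristic polynomial kills.\<close>

lemma eventually_dvd_mat_poly:
  assumes "u \<in> carrier_vec n" "eventually_dvd M e u"
  shows "eventually_dvd M e (mat_poly M g *\<^sub>v u)"
proof -
  obtain m where m: "dvd_vec e (mat_poly M (monom 1 m) *\<^sub>v u)"
    using assms by (auto simp: eventually_dvd_def)
  have "mat_poly M (monom 1 m) *\<^sub>v (mat_poly M g *\<^sub>v u)
      = mat_poly M g *\<^sub>v (mat_poly M (monom 1 m) *\<^sub>v u)"
    using assms mat_poly_mult_vec[OF M assms(1)] by (metis mult.commute)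
  then show ?thesis unfolding eventually_dvd_def
    using dvd_vec_mult_mat[OF mat_poly_carrier[OF M] _ m] assms mat_poly_carrier[OF M]
    by (metis mult_mat_vec_carrier)
qed

text \<open>A vector killed by \<open>f(M)\<close> generates a module over \<open>Z[x]/(f)\<close>,
  so its images can be computed with remainders modulo \<open>f\<close>.\<close>

lemma mat_poly_cong:
  assumes u: "u \<in> carrier_vec n" and f: "mat_poly M f *\<^sub>v u = 0\<^sub>v n" and dvd: "f dvd g - h"
  shows "mat_poly M g *\<^sub>v u = mat_poly M h *\<^sub>v u"
proof -
  obtain q where "g - h = f * q" using dvd by (elim dvdE)
  then have g: "g = q * f + h" by (simp add: algebra_simps)
  have "mat_poly M g *\<^sub>v u = mat_poly M (q * f) *\<^sub>v u + mat_poly M h *\<^sub>v u"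
    unfolding g mat_poly_add[OF M]
    by (rule add_mult_distrib_mat_vec[OF mat_poly_carrier[OF M] mat_poly_carrier[OF M] u])
  also have "mat_poly M (q * f) *\<^sub>v u = 0\<^sub>v n"
    unfolding mat_poly_mult_vec[OF M u] f using mat_poly_dim[OF M, of q]
    by (intro eq_vecI) (auto simp: scalar_prod_def)
  finally show ?thesis
    using mult_mat_vec_carrier[OF mat_poly_carrier[OF M, of h] u] by simp
qed

text \<open>Supplies the hypothesis \<open>ev\<close> of
  \<open>not_cyclic_subgroup_separable\<close> for the vector found in
  \<open>divisor_char_poly_singular\<close>.\<close>

lemma eventually_dvd_power_if_cong:
  assumes u: "u \<in> carrier_vec n" and f: "mat_poly M f *\<^sub>v u = 0\<^sub>v n"
    and cong: "poly_cong f (monom 1 (degree f)) p"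
  shows "eventually_dvd M (int p ^ k) u"
proof -
  let ?d = "degree f"
  have "[:int p:] dvd monom 1 ?d - f"
    using cong by (auto simp: poly_cong_def const_poly_dvd_iff cong_iff_dvd_diff dvd_diff_commute)
  then obtain g where g: "monom 1 ?d - f = [:int p:] * g" by (elim dvdE)
  then have "monom 1 ?d - [:int p:] * g = f" by (metis add_diff_cancel_left' diff_add_cancel)
  then have "f dvd monom 1 ?d - [:int p:] * g" by simp
  \<comment> \<open>\<open>power_diff_sumr2\<close> exhibits \<open>a - b\<close> as a factor of
    \<open>a ^ k - b ^ k\<close>.\<close>
  also have "\<dots> dvd monom 1 ?d ^ k - ([:int p:] * g) ^ k"
    unfolding power_diff_sumr2 by simp
  also have "monom 1 ?d ^ k - ([:int p:] * g) ^ k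
      = monom 1 (?d * k) - Polynomial.smult (int p ^ k) (g ^ k)"
    by (simp add: monom_power smult_power mult.commute)
  finally have "mat_poly M (monom 1 (?d * k)) *\<^sub>v u
      = mat_poly M (Polynomial.smult (int p ^ k) (g ^ k)) *\<^sub>v u"
    by (rule mat_poly_cong[OF u f])
  also have "\<dots> = int p ^ k \<cdot>\<^sub>v (mat_poly M (g ^ k) *\<^sub>v u)"
    unfolding mat_poly_smult[OF M] using u mat_poly_dim[OF M] by (intro eq_vecI) auto
  finally show ?thesis unfolding eventually_dvd_def dvd_vec_def
    by (intro exI[of _ "?d * k"]) (simp del: index_mult_mat_vec)
qed

text \<open>A polynomial \<open>h\<close> of least degree killing \<open>u\<close> divides a nonzero
  integer multiple of \<open>f\<close>. Irreducibility then makes \<open>h\<close> constant or of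
  the same degree as \<open>f\<close>, and a nonzero constant cannot kill \<open>u\<close>.\<close>

lemma annihilator_degree:
  assumes u: "u \<in> carrier_vec n" "u \<noteq> 0\<^sub>v n" and f: "mat_poly M f *\<^sub>v u = 0\<^sub>v n"
    and irr: "irreducible (map_poly rat_of_int f)"
    and g: "g \<noteq> 0" "mat_poly M g *\<^sub>v u = 0\<^sub>v n"
  shows "degree f \<le> degree g"
proof -
  let ?P = "\<lambda>g. g \<noteq> 0 \<and> mat_poly M g *\<^sub>v u = 0\<^sub>v n"
  obtain h where h: "h \<noteq> 0" "mat_poly M h *\<^sub>v u = 0\<^sub>v n" and
    min: "\<And>r. ?P r \<Longrightarrow> degree h \<le> degree r"
    using ex_has_least_nat[of ?P g degree] g by blast
  \<comment> \<open>The leading coefficient of \<open>h\<close> may differ from 1, so division needs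
    the factor \<open>a\<close>.\<close>
  obtain q r where qr: "pseudo_divmod f h = (q, r)" by force
  define a where "a = coeff h (degree h) ^ (Suc (degree f) - degree h)"
  have id: "Polynomial.smult a f = h * q + r" and r: "r = 0 \<or> degree r < degree h"
    using pseudo_divmod[OF h(1) qr] by (auto simp: a_def)
  have a: "a \<noteq> 0" using h(1) by (simp add: a_def)
  have 0: "mat_poly M 0 *\<^sub>v u = 0\<^sub>v n" using u by (auto simp: mat_poly_0[OF M])
  have "mat_poly M (Polynomial.smult a f) *\<^sub>v u = 0\<^sub>v n"
    using mat_poly_cong[OF u(1) f, of "Polynomial.smult a f" 0] 0 by (simp add: dvd_smult)
  moreover have "h dvd Polynomial.smult a f - r" by (simp add: id)
  ultimately have "mat_poly M r *\<^sub>v u = 0\<^sub>v n"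
    using mat_poly_cong[OF u(1) h(2)] by metis
  then have "r = 0" using r min[of r] by fastforce
  then have "map_poly rat_of_int (Polynomial.smult a f) = map_poly rat_of_int (h * q)"
    using id by simp
  then have eq: "Polynomial.smult (rat_of_int a) (map_poly rat_of_int f)
      = map_poly rat_of_int h * map_poly rat_of_int q"
    by (simp add: hom_distribs)
  have f0: "f \<noteq> 0" using irr by auto
  \<comment> \<open>Over the rationals \<open>a\<close> is invertible; moving it onto
    \<open>h\<close> gives a factorization of \<open>f\<close> itself.\<close>
  have "map_poly rat_of_int f
      = Polynomial.smult (1 / rat_of_int a) (map_poly rat_of_int h) * map_poly rat_of_int q"
    using a arg_cong[OF eq, of "Polynomial.smult (1 / rat_of_int a)"] by simp
  then have "Polynomial.smult (1 / rat_of_int a) (map_poly rat_of_int h) dvd 1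
      \<or> map_poly rat_of_int q dvd 1"
    using irreducibleD[OF irr] by blast
  then have "degree h = 0 \<or> degree q = 0"
    using a by (auto simp: poly_dvd_1)
  moreover have "degree h \<noteq> 0"
  proof
    assume "degree h = 0"
    then obtain c where c: "h = [:c:]" by (elim degree_eq_zeroE)
    have "(c \<cdot>\<^sub>m 1\<^sub>m n) *\<^sub>v u = c \<cdot>\<^sub>v u" using u(1) by auto
    then have "c \<cdot>\<^sub>v u = 0\<^sub>v n"
      using h(2) u(1) M mat_poly_0[OF M] unfolding c mat_poly_pCons[OF M] by simp
    moreover have "c \<noteq> 0" using h(1) c by simp
    ultimately show False using u smult_vec_eq_0_iff by blast
  qed
  ultimately have "degree q = 0" by simp
  moreover have "degree f = degree h + degree q"
  proof -
    have q0: "q \<noteq> 0" using id \<open>r = 0\<close> a f0 by auto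
    have "degree (Polynomial.smult a f) = degree h + degree q"
      using id \<open>r = 0\<close> h(1) q0 by (simp add: degree_mult_eq)
    then show ?thesis using a by simp
  qed
  ultimately show ?thesis using min[of g] g by simp
qed

end

section \<open>Integral left inverses and factors of \<open>x^m\<close> modulo a prime\<close>

text \<open>The Gram matrix \<open>W\<close> is nonsingular: if it kills \<open>c\<close>, then
  \<open>V *\<^sub>v c\<close> is orthogonal to itself and vanishes by positivity. The adjugate of
  \<open>W\<close> times the transpose of \<open>V\<close> is a left inverse up to
  \<open>D = det W\<close>.\<close>

lemma full_column_rank_left_inverse:
  fixes V :: "int mat"
  assumes V: "V \<in> carrier_mat n d" and inj: "\<And>c. c \<in> carrier_vec d \<Longrightarrow> V *\<^sub>v c = 0\<^sub>v n \<Longrightarrow> c = 0\<^sub>v d"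
  shows "\<exists>U\<in>carrier_mat d n. \<exists>D. D \<noteq> 0 \<and> U * V = D \<cdot>\<^sub>m 1\<^sub>m d"
proof -
  define W where "W = transpose_mat V * V"
  have W: "W \<in> carrier_mat d d" using V by (simp add: W_def)
  have "det W \<noteq> 0"
  proof
    assume "det W = 0"
    then obtain c where c: "c \<in> carrier_vec d" "c \<noteq> 0\<^sub>v d" "W *\<^sub>v c = 0\<^sub>v d"
      using det_0_iff_vec_prod_zero[OF W] by blast
    let ?y = "V *\<^sub>v c"
    have y: "?y \<in> carrier_vec n" using V c by simp
    have "transpose_mat V *\<^sub>v ?y = 0\<^sub>v d"
      using V c unfolding W_def by (subst (asm) assoc_mult_mat_vec[of _ d n _ d]) auto
    then have "?y \<bullet> ?y = 0"
      using transpose_vec_mult_scalar[OF V c(1) y] c(1) by simp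
    then have "(\<Sum>i<n. (?y $ i)\<^sup>2) = 0"
      using y V by (simp add: scalar_prod_def power2_eq_square lessThan_atLeast0)
    then have "\<forall>i<n. ?y $ i = 0" by (subst (asm) sum_nonneg_eq_0_iff) auto
    then have "?y = 0\<^sub>v n" using y V by (intro eq_vecI) auto
    then show False using inj c by blast
  qed
  moreover have "adj_mat W * transpose_mat V * V = det W \<cdot>\<^sub>m 1\<^sub>m d"
    using adj_mat[OF W] V by (subst assoc_mult_mat[of _ d d _ n _ d]) (auto simp: W_def)
  moreover have "adj_mat W * transpose_mat V \<in> carrier_mat d n"
    using adj_mat(1)[OF W] V by auto
  ultimately show ?thesis by blast
qed

text \<open>Modulo \<open>p\<close> the equation reads \<open>x^m = f q\<close>, and a monic divisor
  of a power of \<open>x\<close> over a field is a power of \<open>x\<close>. As in Gauss's lemma,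
  the lowest coefficients of \<open>f\<close> and \<open>q\<close> prime to \<open>p\<close>
  multiply to a coefficient of \<open>f * q\<close> prime to \<open>p\<close>; this must be the one
  of index \<open>m\<close>.\<close>

lemma monic_dvd_monom_mod_prime:
  fixes f q r :: "int poly"
  assumes p: "prime p" and f: "lead_coeff f = 1" and eq: "monom 1 m = f * q + r"
    and deg: "r = 0 \<or> degree r < degree f" and r: "\<And>k. int p dvd coeff r k" and k: "k < degree f"
  shows "int p dvd coeff f k"
proof -
  let ?P = "\<lambda>g i. \<not> int p dvd coeff g i"
  have pp: "prime (int p)" using p by simp
  then have p1: "\<not> int p dvd 1" by auto
  \<comment> \<open>Otherwise \<open>r = monom 1 m\<close>, whose coefficient 1 is not divisible by
    \<open>p\<close>.\<close>
  have q0: "q \<noteq> 0"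
    using eq r[of m] p1 by auto
  have f0: "f \<noteq> 0" using f by auto
  have "coeff r (degree f + degree q) = 0"
    using deg by (auto intro: coeff_eq_0)
  then have "coeff (monom 1 m) (degree f + degree q) = lead_coeff q"
    using eq f by (simp add: coeff_mult_degree_sum)
  then have m: "m = degree f + degree q" and lq: "lead_coeff q = 1"
    using q0 by (auto split: if_splits)
  define i where "i = (LEAST i. ?P f i)"
  define j where "j = (LEAST j. ?P q j)"
  have Pf: "?P f (degree f)" and Pq: "?P q (degree q)"
    using f lq p1 by simp_all
  have i: "?P f i" "i \<le> degree f"
    unfolding i_def by (rule LeastI[of "?P f", OF Pf], rule Least_le[of "?P f", OF Pf])
  have j: "?P q j" "j \<le> degree q"
    unfolding j_def by (rule LeastI[of "?P q", OF Pq], rule Least_le[of "?P q", OF Pq])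
  have less: "int p dvd coeff f s" if "s < i" for s
    using not_less_Least[of s "?P f"] that by (simp add: i_def)
  have less': "int p dvd coeff q s" if "s < j" for s
    using not_less_Least[of s "?P q"] that by (simp add: j_def)
  have "i = degree f"
  proof (rule ccontr)
    assume "i \<noteq> degree f"
    then have "i + j < m" using i(2) j(2) m by simp
    then have "coeff (f * q) (i + j) = - coeff r (i + j)"
      using arg_cong[OF eq, of "\<lambda>g. coeff g (i + j)"] by simp
    then have "int p dvd coeff (f * q) (i + j)" using r by simp
    also have "coeff (f * q) (i + j) = coeff f i * coeff q j
        + (\<Sum>s\<in>{..i + j} - {i}. coeff f s * coeff q (i + j - s))"
      unfolding coeff_mult by (subst sum.remove[of _ i]) auto
    finally have "int p dvd coeff f i * coeff q j"
    proof (subst (asm) dvd_add_left_iff)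
      show "int p dvd (\<Sum>s\<in>{..i + j} - {i}. coeff f s * coeff q (i + j - s))"
      proof (intro dvd_sum)
        \<comment> \<open>An index \<open>s > i\<close> leaves \<open>i + j - s < j\<close>, so one
          of the two factors lies below its least index.\<close>
        fix s assume s: "s \<in> {..i + j} - {i}"
        then consider "s < i" | "i + j - s < j" by force
        then show "int p dvd coeff f s * coeff q (i + j - s)"
          using less less' by cases auto
      qed
    qed
    then show False using pp i(1) j(1) prime_dvd_multD by blast
  qed
  then show ?thesis using less k by blast
qed

text \<open>The modulus exceeds the absolute value of \<open>s\<close>, so a finite cyclic quotient
  detects whether an exponent sum is zero.\<close>

lemma int_mod_Suc_abs_eq_0: "(s :: int) mod int (Suc (nat \<bar>s\<bar>)) = 0 \<Longrightarrow> s = 0"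
  using zdvd_imp_le[of "int (Suc (nat \<bar>s\<bar>))" "\<bar>s\<bar>"] by (cases "s = 0") (auto simp: mod_eq_0_iff_dvd)

context
  fixes M :: "int mat" and n :: nat
  assumes M: "M \<in> carrier_mat n n"
begin

text \<open>Since \<open>u, M u, \<dots>\<close> (up to \<open>degree f - 1\<close>) have a left inverse up to an integer \<open>D\<close>, divisibility
  of \<open>M\<^sup>m u\<close> by a power of \<open>p\<close> exceeding \<open>\<bar>D\<bar>\<close> forces \<open>p\<close> to divide \<open>x\<^sup>m mod f\<close>. Then \<open>f\<close> divides \<open>x\<^sup>m\<close>
  modulo \<open>p\<close>.\<close>

lemma irreducible_not_infinitely_dvd:
  assumes u: "u \<in> carrier_vec n" "u \<noteq> 0\<^sub>v n" and f: "mat_poly M f *\<^sub>v u = 0\<^sub>v n"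
    and irr: "irreducible (map_poly rat_of_int f)" and monic: "lead_coeff f = 1"
    and p: "prime p" and ncong: "\<not> poly_cong f (monom 1 (degree f)) p"
  shows "\<exists>k. \<not> eventually_dvd M (int p ^ k) u"
proof (rule ccontr)
  assume "\<nexists>k. \<not> eventually_dvd M (int p ^ k) u"
  then have ev: "eventually_dvd M (int p ^ k) u" for k by blast
  define d where "d = degree f"
  \<comment> \<open>The columns are \<open>u, M u, ...\<close>, so \<open>V\<close> turns the
    coefficient vector of a polynomial \<open>r\<close> of degree below \<open>d\<close> into
    \<open>r(M) u\<close>.\<close>
  define V where "V = mat n d (\<lambda>(i, s). (mat_poly M (monom 1 s) *\<^sub>v u) $ i)"
  have V: "V \<in> carrier_mat n d" by (simp add: V_def)
  have Vc: "V *\<^sub>v vec d (coeff r) = mat_poly M r *\<^sub>v u" if r: "r = 0 \<or> degree r < d" for r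
  proof (rule eq_vecI)
    fix i assume "i < dim_vec (mat_poly M r *\<^sub>v u)"
    then have i: "i < n" using mat_poly_dim[OF M] by simp
    have row: "(mat_poly M g *\<^sub>v u) $ i = (\<Sum>j<n. mat_poly M g $$ (i, j) * u $ j)" for g
      using i u(1) mat_poly_dim[OF M, of g] by (simp add: scalar_prod_def lessThan_atLeast0)
    have "r = (\<Sum>s<d. Polynomial.smult (coeff r s) (monom 1 s))"
      using r by (intro poly_eqI)
        (auto simp: coeff_sum if_distrib[of "(*) _"] cong: if_cong intro: coeff_eq_0)
    then have "mat_poly M r $$ (i, j) = (\<Sum>s<d. coeff r s * mat_poly M (monom 1 s) $$ (i, j))"
      if j: "j < n" for j
      using mat_poly_sum_index[OF M i j, of "\<lambda>s. Polynomial.smult (coeff r s) (monom 1 s)" "{..<d}"]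
        i j mat_poly_dim[OF M]
      by (simp add: mat_poly_smult[OF M] flip: smult_monom)
    then have "(mat_poly M r *\<^sub>v u) $ i
        = (\<Sum>j<n. \<Sum>s<d. coeff r s * mat_poly M (monom 1 s) $$ (i, j) * u $ j)"
      unfolding row by (simp add: sum_distrib_right)
    also have "\<dots> = (\<Sum>s<d. coeff r s * (mat_poly M (monom 1 s) *\<^sub>v u) $ i)"
      unfolding row by (subst sum.swap) (simp add: sum_distrib_left mult.assoc)
    also have "\<dots> = (V *\<^sub>v vec d (coeff r)) $ i"
      using i by (simp add: V_def scalar_prod_def lessThan_atLeast0 mult.commute
          del: index_mult_mat_vec(1)) (simp add: V_def scalar_prod_def mult.commute)
    finally show "(V *\<^sub>v vec d (coeff r)) $ i = (mat_poly M r *\<^sub>v u) $ i" by simp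
  qed (use V mat_poly_dim[OF M] in simp)
  \<comment> \<open>A linear relation among the columns is a polynomial of degree below
    \<open>d\<close> that kills \<open>u\<close>.\<close>
  have inj: "c = 0\<^sub>v d" if c: "c \<in> carrier_vec d" "V *\<^sub>v c = 0\<^sub>v n" for c
  proof -
    define r where "r = (\<Sum>s<d. monom (c $ s) s)"
    have coeff: "coeff r s = (if s < d then c $ s else 0)" for s
      by (simp add: r_def coeff_sum)
    then have deg: "r = 0 \<or> degree r < d"
      by (metis leading_coeff_0_iff)
    have "c = vec d (coeff r)" using c(1) by (intro eq_vecI) (auto simp: coeff)
    then have "mat_poly M r *\<^sub>v u = 0\<^sub>v n" using Vc[OF deg] c(2) by simp
    then have "r = 0"
      using annihilator_degree[OF M u f irr, of r] deg unfolding d_def by fastforce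
    then show ?thesis using c(1) coeff by (intro eq_vecI) (auto, metis coeff_0)
  qed
  obtain U D where U: "U \<in> carrier_mat d n" and D: "D \<noteq> 0" and UV: "U * V = D \<cdot>\<^sub>m 1\<^sub>m d"
    using full_column_rank_left_inverse[OF V inj] by blast
  \<comment> \<open>Then \<open>p ^ k > k = \<bar>D\<bar>\<close>, so \<open>p ^ k\<close> does not
    divide \<open>D\<close>.\<close>
  define k where "k = nat \<bar>D\<bar>"
  obtain m where m: "dvd_vec (int p ^ k) (mat_poly M (monom 1 m) *\<^sub>v u)"
    using ev by (auto simp: eventually_dvd_def)
  obtain q r where qr: "pseudo_divmod (monom 1 m) f = (q, r)" by force
  have f0: "f \<noteq> 0" using monic by auto
  \<comment> \<open>Pseudo-division by the monic \<open>f\<close> is ordinary division.\<close>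
  have eq: "monom 1 m = f * q + r" and r: "r = 0 \<or> degree r < degree f"
    using pseudo_divmod[OF f0 qr] monic by auto
  define c where "c = vec d (coeff r)"
  have c: "c \<in> carrier_vec d" by (simp add: c_def)
  have "mat_poly M (monom 1 m) *\<^sub>v u = V *\<^sub>v c"
    using mat_poly_cong[OF M u(1) f, of "monom 1 m" r] Vc r by (simp add: eq c_def d_def)
  then have "dvd_vec (int p ^ k) (U *\<^sub>v (V *\<^sub>v c))"
    using dvd_vec_mult_mat[OF U _ m] mult_mat_vec_carrier[OF V c] by simp
  also have "U *\<^sub>v (V *\<^sub>v c) = D \<cdot>\<^sub>v c"
    using assoc_mult_mat_vec[OF U V c] smult_one_mat_mult_vec[OF c] unfolding UV by metis
  finally have Dc: "int p ^ k dvd D * coeff r s" if "s < d" for s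
    using that by (auto simp: dvd_vec_def c_def)
  have "int p dvd coeff r s" for s
  proof (cases "s < d")
    case True
    show ?thesis
    proof (rule ccontr)
      assume "\<not> int p dvd coeff r s"
      then have "coprime (int p ^ k) (coeff r s)"
        using p by (intro coprime_power_left_iff[THEN iffD2] disjI1 prime_imp_coprime) auto
      then have "int p ^ k dvd D" using Dc[OF True] coprime_dvd_mult_left_iff by blast
      then have "int p ^ k \<le> int k" using D dvd_imp_le_int[of D "int p ^ k"] by (simp add: k_def)
      moreover have "int k < int p ^ k"
        using power_gt_expt[OF prime_gt_Suc_0_nat[OF p], of k] unfolding of_nat_power[symmetric] of_nat_less_iff .
      ultimately show False by simp
    qed
  next
    case False
    then show ?thesis using r by (auto simp: coeff_eq_0 d_def)
  qed
  then have "int p dvd coeff f k" if "k < degree f" for k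
    using monic_dvd_monom_mod_prime[OF p monic eq r _ that] by blast
  then have "poly_cong f (monom 1 (degree f)) p"
    using monic unfolding poly_cong_def
    by (metis cong_0_iff cong_refl coeff_eq_0 coeff_monom linorder_neqE_nat)
  then show False using ncong by blast
qed

text \<open>Apply the factors to \<open>u\<close> one at a time: the last nonzero vector is killed
  by the next factor.\<close>

lemma annihilated_by_factor:
  assumes "finite I" and u: "u \<in> carrier_vec n" "u \<noteq> 0\<^sub>v n"
    and "mat_poly M (\<Prod>i\<in>I. f i) *\<^sub>v u = 0\<^sub>v n"
  shows "\<exists>i\<in>I. \<exists>g. mat_poly M g *\<^sub>v u \<noteq> 0\<^sub>v n \<and> mat_poly M (f i) *\<^sub>v (mat_poly M g *\<^sub>v u) = 0\<^sub>v n"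
  using assms(1,4)
proof (induction I rule: finite_induct)
  case empty
  then show ?case using u by (simp add: mat_poly_1[OF M])
next
  case (insert i I)
  then show ?case
    by (cases "mat_poly M (\<Prod>i\<in>I. f i) *\<^sub>v u = 0\<^sub>v n") (auto simp: mat_poly_mult_vec[OF M u(1)])
qed

text \<open>Cayley-Hamilton provides a nonzero \<open>mat_poly M g *\<^sub>v u\<close> killed by a
  single \<open>f i\<close>. The irreducible case applies to it, and a failure of divisibility there
  is a failure for \<open>u\<close>.\<close>

theorem not_infinitely_dvd:
  assumes "finite I" and char_poly: "char_poly M = (\<Prod>i\<in>I. f i)"
    and monic: "\<And>i. i \<in> I \<Longrightarrow> lead_coeff (f i) = 1"
    and irr: "\<And>i. i \<in> I \<Longrightarrow> irreducible (map_poly rat_of_int (f i))"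
    and ncong: "\<And>i. i \<in> I \<Longrightarrow> \<not> poly_cong (f i) (monom 1 (degree (f i))) p"
    and p: "prime p" and u: "u \<in> carrier_vec n" "u \<noteq> 0\<^sub>v n"
  shows "\<exists>k. \<not> eventually_dvd M (int p ^ k) u"
proof -
  have "mat_poly M (\<Prod>i\<in>I. f i) *\<^sub>v u = 0\<^sub>v n"
    using u(1) cayley_hamilton[OF M] by (auto simp flip: char_poly)
  then obtain i g where i: "i \<in> I" and g: "mat_poly M g *\<^sub>v u \<noteq> 0\<^sub>v n"
    "mat_poly M (f i) *\<^sub>v (mat_poly M g *\<^sub>v u) = 0\<^sub>v n"
    using annihilated_by_factor[OF \<open>finite I\<close> u] by blast
  have "mat_poly M g *\<^sub>v u \<in> carrier_vec n"
    using mat_poly_carrier[OF M] u by (meson mult_mat_vec_carrier)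
  then obtain k where "\<not> eventually_dvd M (int p ^ k) (mat_poly M g *\<^sub>v u)"
    using irreducible_not_infinitely_dvd g irr monic ncong p i by blast
  then show ?thesis using eventually_dvd_mat_poly[OF M u(1)] by blast
qed

section \<open>Moduli prime to the determinant\<close>

text \<open>By the adjugate formula \<open>M\<close> is invertible modulo \<open>e\<close>, so its
  applications can be cancelled one by one.\<close>

lemma eventually_dvd_coprime_det:
  assumes cop: "coprime e (det M)" and v: "v \<in> carrier_vec n" and ev: "eventually_dvd M e v"
  shows "dvd_vec e v"
proof -
  have step: "dvd_vec e w" if w: "w \<in> carrier_vec n" and "dvd_vec e (M *\<^sub>v w)" for w
  proof -
    have "dvd_vec e (adj_mat M *\<^sub>v (M *\<^sub>v w))"
      using M w by (intro dvd_vec_mult_mat[OF adj_mat(1)[OF M] _ that(2)]) auto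
    also have "adj_mat M *\<^sub>v (M *\<^sub>v w) = det M \<cdot>\<^sub>v w"
      using assoc_mult_mat_vec[OF adj_mat(1)[OF M] M w] smult_one_mat_mult_vec[OF w]
      unfolding adj_mat(3)[OF M] by metis
    finally show ?thesis using cop
      by (auto simp: dvd_vec_def coprime_dvd_mult_right_iff)
  qed
  obtain m where "dvd_vec e (mat_poly M (monom 1 m) *\<^sub>v v)"
    using ev by (auto simp: eventually_dvd_def)
  then show ?thesis
  proof (induction m)
    case 0
    then show ?case using v by (simp add: mat_poly_1[OF M])
  next
    case (Suc m)
    have "monom 1 (Suc m) = [:0, 1:] * monom (1::int) m" by (simp add: monom_Suc)
    then have "mat_poly M (monom 1 (Suc m)) *\<^sub>v v = M *\<^sub>v (mat_poly M (monom 1 m) *\<^sub>v v)"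
      using mat_poly_mult_vec[OF M v] mat_poly_X[OF M] by metis
    then have "dvd_vec e (mat_poly M (monom 1 m) *\<^sub>v v)"
      using Suc.prems step mat_poly_carrier[OF M] v by (metis mult_mat_vec_carrier)
    then show ?case by (rule Suc.IH)
  qed
qed

text \<open>The free factor \<open>k\<close> allows the modulus to be made as large as desired when
  \<open>det M \<noteq> 0\<close>.\<close>

lemma coprime_det_Suc:
  "coprime (int (Suc (nat \<bar>det M\<bar> * k))) (det M)"
proof -
  have "coprime (1 + det M * sgn (det M) * int k) (det M)"
    by (rule coprimeI) (metis dvd_add_left_iff dvd_mult2)
  moreover have "int (Suc (nat \<bar>det M\<bar> * k)) = 1 + det M * sgn (det M) * int k"
    by (simp flip: abs_sgn)
  ultimately show ?thesis by (simp only:)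
qed

text \<open>Residual finiteness of the direct limit: a modulus prime to \<open>det M\<close> and
  larger than a nonzero coordinate of \<open>v\<close> suffices.\<close>

lemma nonzero_not_eventually_dvd:
  assumes det: "det M \<noteq> 0" and v: "v \<in> carrier_vec n" "v \<noteq> 0\<^sub>v n"
  shows "\<exists>e>0. \<not> eventually_dvd M (int e) v"
proof -
  obtain r where r: "r < n" "v $ r \<noteq> 0" using v by (metis carrier_vecD eq_vecI index_zero_vec)
  define e where "e = Suc (nat \<bar>det M\<bar> * nat \<bar>v $ r\<bar>)"
  have "\<not> eventually_dvd M (int e) v"
  proof
    assume "eventually_dvd M (int e) v"
    then have "dvd_vec (int e) v"
      using eventually_dvd_coprime_det[OF _ v(1)] coprime_det_Suc unfolding e_def by blast
    then have "int e dvd v $ r" using r v(1) by (auto simp: dvd_vec_def)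
    then have "int e \<le> \<bar>v $ r\<bar>" using r dvd_imp_le_int[of "v $ r" "int e"] by simp
    then have "nat \<bar>det M\<bar> * nat \<bar>v $ r\<bar> < nat \<bar>v $ r\<bar>" unfolding e_def by linarith
    then show False using det by simp
  qed
  then show ?thesis unfolding e_def by blast
qed

text \<open>If \<open>a\<close> and \<open>c\<close> are independent, every \<open>e\<close> prime to \<open>det M\<close> and larger than some nonzero minor
  will do. Otherwise \<open>a = x u\<close> and \<open>c = y u\<close> with \<open>x\<close>, \<open>y\<close> coprime, and a power of a prime divisor
  of \<open>x\<close> will do.\<close>

theorem cyclic_separated_mod_eventually_dvd:
  assumes det: "det M \<noteq> 0"
    and ndvd: "\<And>p u. prime p \<Longrightarrow> u \<in> carrier_vec n \<Longrightarrow> u \<noteq> 0\<^sub>v n \<Longrightarrow> \<exists>k. \<not> eventually_dvd M (int p ^ k) u"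
    and a: "a \<in> carrier_vec n" and c: "c \<in> carrier_vec n" and ac: "\<And>i. c \<noteq> i \<cdot>\<^sub>v a"
  shows "\<exists>e>0. \<forall>i. \<not> eventually_dvd M (int e) (c - i \<cdot>\<^sub>v a)"
proof (cases "a = 0\<^sub>v n")
  case True
  then have "c - i \<cdot>\<^sub>v a = c" for i using c by (intro eq_vecI) auto
  moreover have "c \<noteq> 0\<^sub>v n" using ac[of 0] True by auto
  ultimately show ?thesis using nonzero_not_eventually_dvd[OF det c] by simp
next
  case a0: False
  show ?thesis
  proof (cases "\<exists>r s. r < n \<and> s < n \<and> a $ r * c $ s \<noteq> a $ s * c $ r")
    case True
    then obtain r s where rs: "r < n" "s < n" and D0: "a $ r * c $ s - a $ s * c $ r \<noteq> 0" by auto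
    define D where "D = a $ r * c $ s - a $ s * c $ r"
    define e where "e = Suc (nat \<bar>det M\<bar> * nat \<bar>D\<bar>)"
    have "\<not> eventually_dvd M (int e) (c - i \<cdot>\<^sub>v a)" for i
    proof
      assume "eventually_dvd M (int e) (c - i \<cdot>\<^sub>v a)"
      then have "dvd_vec (int e) (c - i \<cdot>\<^sub>v a)"
        using eventually_dvd_coprime_det[of "int e" "c - i \<cdot>\<^sub>v a"] coprime_det_Suc a c
        unfolding e_def by (meson minus_carrier_vec smult_carrier_vec)
      then have "int e dvd c $ r - i * a $ r" "int e dvd c $ s - i * a $ s"
        using rs a c by (auto simp: dvd_vec_def)
      \<comment> \<open>This combination of the two coordinates eliminates \<open>i\<close> and
        leaves the minor \<open>D\<close>.\<close>
      then have "int e dvd a $ r * (c $ s - i * a $ s) - a $ s * (c $ r - i * a $ r)"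
        by (intro dvd_diff[OF dvd_mult dvd_mult])
      also have "\<dots> = D" by (simp add: D_def algebra_simps)
      finally have "int e \<le> \<bar>D\<bar>" using D0 dvd_imp_le_int[of D "int e"] by (simp add: D_def)
      then have "nat \<bar>det M\<bar> * nat \<bar>D\<bar> < nat \<bar>D\<bar>" unfolding e_def by linarith
      then show False using det by simp
    qed
    then show ?thesis unfolding e_def by blast
  next
    case False
    obtain r where r: "r < n" "a $ r \<noteq> 0" using a a0 by (metis carrier_vecD eq_vecI index_zero_vec)
    define g where "g = gcd (a $ r) (c $ r)"
    define x where "x = a $ r div g"
    define y where "y = c $ r div g"
    have g0: "g \<noteq> 0" using r by (simp add: g_def)
    have ar: "a $ r = g * x" and cr: "c $ r = g * y" by (simp_all add: g_def x_def y_def)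
    have cop: "coprime x y" using r unfolding x_def y_def g_def by (intro div_gcd_coprime) auto
    have xy: "x * c $ s = y * a $ s" if "s < n" for s
    proof -
      have "a $ r * c $ s = a $ s * c $ r" using False r(1) that by blast
      then have "g * (x * c $ s) = g * (y * a $ s)" by (simp add: ar cr ac_simps)
      then show ?thesis using g0 by simp
    qed
    then have "x dvd a $ s" if "s < n" for s
      using coprime_dvd_mult_right_iff[OF cop, of "a $ s"] xy[OF that] dvd_triv_left[of x "c $ s"]
      by simp
    then have "dvd_vec x a" using a by (auto simp: dvd_vec_def)
    then obtain u where u: "u \<in> carrier_vec n" and au: "a = x \<cdot>\<^sub>v u" using dvd_vec_iff_smult[OF a] by blast
    have x0: "x \<noteq> 0" using ar r by auto
    have cu: "c = y \<cdot>\<^sub>v u"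
    proof (rule eq_vecI)
      fix s assume "s < dim_vec (y \<cdot>\<^sub>v u)"
      then have "s < n" using u by simp
      then have "x * c $ s = x * (y * u $ s)" using xy au u by simp
      then show "c $ s = (y \<cdot>\<^sub>v u) $ s" using x0 \<open>s < n\<close> u by simp
    qed (use c u in simp)
    have u0: "u \<noteq> 0\<^sub>v n" using a0 au by auto
    have "\<not> x dvd 1"
    proof
      assume "x dvd 1"
      then have "x = 1 \<or> x = -1" by auto
      \<comment> \<open>A unit \<open>x\<close> has square 1, which would make \<open>c\<close> a
        multiple of \<open>a\<close>.\<close>
      then have yxx: "y * x * x = y" by auto
      have "(y * x) \<cdot>\<^sub>v a = c" unfolding au cu smult_smult_assoc yxx ..
      then show False using ac by blast
    qed
    then have "nat \<bar>x\<bar> \<noteq> 1" by (auto simp: nat_eq_iff split: abs_split)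
    then obtain p where p: "prime p" "int p dvd x"
      using prime_factor_nat dvd_nat_abs_iff by blast
    have py: "\<not> int p dvd y" using not_coprimeI[OF p(2), of y] cop prime_gt_1_nat[OF p(1)] by auto
    obtain k where k: "\<not> eventually_dvd M (int p ^ k) u" using ndvd[OF p(1) u u0] by blast
    have "\<not> eventually_dvd M (int (p ^ k)) (c - i \<cdot>\<^sub>v a)" for i
    proof
      assume "eventually_dvd M (int (p ^ k)) (c - i \<cdot>\<^sub>v a)"
      then obtain m where m: "dvd_vec (int p ^ k) (mat_poly M (monom 1 m) *\<^sub>v (c - i \<cdot>\<^sub>v a))"
        by (auto simp: eventually_dvd_def)
      \<comment> \<open>For every \<open>i\<close>, \<open>c - i \<cdot>\<^sub>v a\<close> is the
        multiple \<open>z\<close> of \<open>u\<close>. As \<open>p\<close> divides \<open>x\<close>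
        but not \<open>y\<close>, it never divides \<open>z\<close>.\<close>
      define z where "z = y - i * x"
      have "\<not> int p dvd z" using p(2) py unfolding z_def by (simp add: dvd_diff_left_iff)
      then have cop: "coprime (int p ^ k) z" 
        using p by (intro coprime_power_left_iff[THEN iffD2] disjI1 prime_imp_coprime) auto
      have "c - i \<cdot>\<^sub>v a = z \<cdot>\<^sub>v u" unfolding cu au z_def using u
        by (intro eq_vecI) (auto simp: algebra_simps)
      then have "dvd_vec (int p ^ k) (z \<cdot>\<^sub>v (mat_poly M (monom 1 m) *\<^sub>v u))"
        using m mult_mat_vec_smult[OF mat_poly_carrier[OF M] u] by simp
      then have "dvd_vec (int p ^ k) (mat_poly M (monom 1 m) *\<^sub>v u)"
        using coprime_dvd_mult_right_iff[OF cop] by (simp add: dvd_vec_def)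
      then show False using k by (auto simp: eventually_dvd_def)
    qed
    moreover have "p ^ k > 0" using p(1) prime_gt_0_nat by simp
    ultimately show ?thesis by blast
  qed
qed

end

section \<open>Finite index subgroups and finite quotients\<close>

lemma (in group) conj_int_pow:
  assumes "s \<in> carrier G" "x \<in> carrier G"
  shows "(s \<otimes> x \<otimes> inv s) [^] (i::int) = s \<otimes> x [^] i \<otimes> inv s"
proof -
  have "(\<lambda>x. s \<otimes> x \<otimes> inv s) \<in> hom G G"
    using assms(1) by (intro homI) (simp_all add: m_assoc inv_solve_left)
  then show ?thesis using hom_int_pow[OF _ assms(2) is_group is_group] by metis
qed

lemma (in comm_group) finprod_int_pow:
  "f \<in> I \<rightarrow> carrier G \<Longrightarrow> (\<Otimes>i\<in>I. f i) [^] (k::int) = (\<Otimes>i\<in>I. f i [^] k)"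
  by (induction I rule: infinite_finite_induct) (auto simp: int_pow_distrib Pi_iff)

lemma hom_finprod:
  assumes "comm_group G" "comm_group H" and h: "h \<in> hom G H" and f: "f \<in> I \<rightarrow> carrier G"
  shows "h (\<Otimes>\<^bsub>G\<^esub>i\<in>I. f i) = (\<Otimes>\<^bsub>H\<^esub>i\<in>I. h (f i))"
proof -
  interpret G: comm_group G by fact
  interpret H: comm_group H by fact
  interpret h: group_hom G H h using h by unfold_locales
  show ?thesis using f by (induction I rule: infinite_finite_induct) (auto simp: Pi_iff)
qed

text \<open>The map \<open>r\<close> need not be a homomorphism: one representative for each of its
  values already meets every coset.\<close>

lemma (in group) finite_rcosetsI:
  assumes B: "subgroup B G" and fin: "finite (r ` carrier G)"
    and r: "\<And>x y. x \<in> carrier G \<Longrightarrow> y \<in> carrier G \<Longrightarrow> r x = r y \<Longrightarrow> x \<otimes> inv y \<in> B"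
  shows "finite (rcosets B)"
proof -
  let ?s = "inv_into (carrier G) r"
  have "rcosets B \<subseteq> (\<lambda>t. B #> ?s t) ` (r ` carrier G)"
  proof
    fix C assume "C \<in> rcosets B"
    then obtain x where x: "x \<in> carrier G" "C = B #> x" by (auto simp: RCOSETS_def)
    have s: "?s (r x) \<in> carrier G" "r (?s (r x)) = r x"
      using x(1) by (auto intro: inv_into_into f_inv_into_f)
    then have "?s (r x) \<otimes> inv x \<in> B" using r x(1) by blast
    then have "?s (r x) \<in> B #> x"
      using subgroup.rcos_module_rev[OF B is_group x(1) s(1)] by blast
    then have "C = B #> ?s (r x)" using x B repr_independence by blast
    then show "C \<in> (\<lambda>t. B #> ?s t) ` (r ` carrier G)" using x(1) by blast
  qed
  then show ?thesis using fin finite_subset by blast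
qed

lemma (in group) finite_index_power:
  assumes K: "subgroup K G" and fin: "finite (rcosets K)"
  shows "\<exists>e>0. \<forall>g\<in>carrier G. g [^] (e::nat) \<in> K"
proof -
  let ?c = "card (rcosets K)"
  have "g [^] (fact ?c :: nat) \<in> K" if g: "g \<in> carrier G" for g
  proof -
    have "(\<lambda>i::nat. K #> g [^] i) ` {0..?c} \<subseteq> rcosets K"
      using g by (auto simp: RCOSETS_def)
    then have "card ((\<lambda>i::nat. K #> g [^] i) ` {0..?c}) < card {0..?c}"
      using card_mono[OF fin] by (metis card_atLeastAtMost diff_zero le_imp_less_Suc)
    then have "\<not> inj_on (\<lambda>i::nat. K #> g [^] i) {0..?c}" using pigeonhole by blast
    then obtain i j :: nat where ij: "i < j" "j \<le> ?c" "K #> g [^] j = K #> g [^] i"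
      unfolding inj_on_def by (metis atLeastAtMost_iff linorder_neqE_nat)
    then have "g [^] j \<in> K #> g [^] i" using g K rcos_self by (metis nat_pow_closed)
    then have "g [^] j \<otimes> inv (g [^] i) \<in> K"
      using subgroup.rcos_module_imp[OF K is_group] g by simp
    moreover have "g [^] j = g [^] (j - i) \<otimes> g [^] i"
      using g ij(1) by (simp add: nat_pow_mult)
    ultimately have "g [^] (j - i) \<in> K" using g by (simp add: m_assoc)
    then have "(g [^] (j - i)) [^] m \<in> K" for m :: nat
      by (induction m) (auto simp: subgroup.one_closed[OF K] subgroup.m_closed[OF K])
    moreover have "j - i dvd fact ?c" using ij by (intro dvd_fact) auto
    ultimately show ?thesis using g by (metis dvdE nat_pow_pow)
  qed
  moreover have "fact ?c > (0::nat)" by simp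
  ultimately show ?thesis by blast
qed

lemma (in group) finite_exponent:
  assumes "finite (carrier G)"
  shows "\<exists>e>0. \<forall>g\<in>carrier G. g [^] (e::nat) = \<one>"
proof -
  have "finite (rcosets {\<one>})"
    by (rule finite_rcosetsI[OF triv_subgroup, of "\<lambda>x. x"]) (use assms in auto)
  then show ?thesis using finite_index_power[OF triv_subgroup] by auto
qed

text \<open>The family consists of all finite-index subgroups containing \<open>H\<close>. The whole
  group belongs to it, which keeps the intersection inside the carrier.\<close>

lemma (in group) separableI:
  assumes H: "subgroup H G"
    and K: "\<And>x. x \<in> carrier G \<Longrightarrow> x \<notin> H \<Longrightarrow>
      \<exists>K. subgroup K G \<and> finite (rcosets K) \<and> H \<subseteq> K \<and> x \<notin> K"
  shows "separable G H"
proof -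
  define \<K> where "\<K> = {K. subgroup K G \<and> finite (rcosets K) \<and> H \<subseteq> K}"
  have "finite (rcosets (carrier G))"
    by (rule finite_rcosetsI[of _ "\<lambda>_. ()"]) (auto simp: subgroup_self)
  then have carr: "carrier G \<in> \<K>"
    using subgroup_self subgroup.subset[OF H] by (auto simp: \<K>_def)
  have "\<Inter>\<K> = H"
  proof
    show "\<Inter>\<K> \<subseteq> H"
    proof
      fix x assume x: "x \<in> \<Inter>\<K>"
      then have "x \<in> carrier G" using carr by blast
      then show "x \<in> H" using K[of x] x by (auto simp: \<K>_def)
    qed
  qed (auto simp: \<K>_def)
  then show ?thesis unfolding separable_def using carr by (intro exI[of _ \<K>]) (auto simp: \<K>_def)
qed

text \<open>\<open>K\<close> is the preimage of the cyclic subgroup generated by \<open>h g\<close>,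
  and the values of \<open>h\<close> distinguish its cosets.\<close>

lemma (in group) separated_by_finite_quotient:
  assumes F: "group F" "finite (carrier F)" and h: "h \<in> hom G F"
    and g: "g \<in> carrier G" and x: "x \<in> carrier G" "h x \<notin> generate F {h g}"
  shows "\<exists>K. subgroup K G \<and> finite (rcosets K) \<and> generate G {g} \<subseteq> K \<and> x \<notin> K"
proof -
  interpret F: group F by fact
  interpret h: group_hom G F h using h by (unfold_locales) auto
  define S where "S = generate F {h g}"
  have S: "subgroup S F" unfolding S_def using g by (intro F.generate_is_subgroup) auto
  define K where "K = {y \<in> carrier G. h y \<in> S}"
  have K: "subgroup K G"
    by (rule subgroupI)
      (auto simp: K_def subgroup.m_inv_closed[OF S] subgroup.m_closed[OF S] subgroup.one_closed[OF S]
        intro!: exI[of _ "\<one>"])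
  moreover have "finite (rcosets K)"
  proof (rule finite_rcosetsI[OF K, of h])
    show "finite (h ` carrier G)"
      by (rule finite_subset[OF _ F(2)]) auto
    show "y \<otimes> inv z \<in> K" if "y \<in> carrier G" "z \<in> carrier G" "h y = h z" for y z
      using that by (simp add: K_def subgroup.one_closed[OF S])
  qed
  moreover have "generate G {g} \<subseteq> K"
    using g by (intro generate_subgroup_incl[OF _ K]) (auto simp: K_def S_def intro: generate.incl)
  moreover have "x \<notin> K" using x by (simp add: K_def S_def)
  ultimately show ?thesis by blast
qed

lemma hom_pair:
  "f \<in> hom G H \<Longrightarrow> g \<in> hom G K \<Longrightarrow> (\<lambda>x. (f x, g x)) \<in> hom G (H \<times>\<times> K)"
  by (auto simp: hom_def)

section \<open>Evaluation of words and the universal property of a presentation\<close>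

definition word_eval :: "('b, 'm) monoid_scheme \<Rightarrow> ('x \<Rightarrow> 'b) \<Rightarrow> 'x word \<Rightarrow> 'b"
  where "word_eval F h w =
    foldr (\<lambda>(x, e) y. (if e then h x else inv\<^bsub>F\<^esub> h x) \<otimes>\<^bsub>F\<^esub> y) w \<one>\<^bsub>F\<^esub>"

context group
begin

context
  fixes X :: "'x set" and h :: "'x \<Rightarrow> 'a"
  assumes h: "h \<in> X \<rightarrow> carrier G"
begin

lemma word_eval_closed: "w \<in> words X \<Longrightarrow> word_eval G h w \<in> carrier G"
  by (induction w) (use h in \<open>auto simp: word_eval_def words_def Pi_iff\<close>)

lemma word_eval_append:
  "u \<in> words X \<Longrightarrow> v \<in> words X \<Longrightarrow> word_eval G h (u @ v) = word_eval G h u \<otimes> word_eval G h v"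
proof (induction u)
  case Nil
  then show ?case using word_eval_closed by (simp add: word_eval_def)
next
  case (Cons l u)
  obtain x e where l: "l = (x, e)" by force
  have u: "u \<in> words X" and x: "h x \<in> carrier G" using Cons.prems h by (auto simp: l words_def)
  show ?case
    using Cons.IH[OF u] Cons.prems(2) word_eval_closed[OF u] word_eval_closed[OF Cons.prems(2)] x
    by (simp add: l word_eval_def m_assoc)
qed

lemma word_eval_eq:
  assumes R: "\<And>r. r \<in> R \<Longrightarrow> r \<in> words X \<Longrightarrow> word_eval G h r = \<one>"
  shows "word_eq X R u v \<Longrightarrow> word_eval G h u = word_eval G h v"
proof (induction rule: word_eq.induct)
  case (cancel u v x e)
  have x: "h x \<in> carrier G" using cancel h by auto
  have w: "[(x, e), (x, \<not> e)] \<in> words X" using cancel by (simp add: words_def)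
  have "word_eval G h [(x, e), (x, \<not> e)] = \<one>" using x by (cases e) (auto simp: word_eval_def)
  then show ?case using cancel w word_eval_closed
    by (simp add: word_eval_append del: append_Cons append_Nil)
next
  case (relator u v r)
  then show ?case using R word_eval_closed by (simp add: word_eval_append)
qed auto

text \<open>Von Dyck's theorem. The map evaluates a chosen word of each class; by
  \<open>word_eval_eq\<close> the choice does not matter.\<close>

lemma presented_group_hom:
  assumes R: "\<And>r. r \<in> R \<Longrightarrow> r \<in> words X \<Longrightarrow> word_eval G h r = \<one>"
  shows "\<exists>\<theta>\<in>hom (presented_group X R) G.
    \<forall>w\<in>words X. \<theta> (word_rel X R `` {w}) = word_eval G h w"
proof -
  define \<theta> where "\<theta> P = word_eval G h (SOME w. w \<in> P)" for P
  have \<theta>: "\<theta> (word_rel X R `` {w}) = word_eval G h w" if w: "w \<in> words X" for w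
  proof -
    have "w \<in> word_rel X R `` {w}" using w by (simp add: word_rel_def word_eq.refl)
    then have "(SOME u. u \<in> word_rel X R `` {w}) \<in> word_rel X R `` {w}" by (rule someI)
    then show ?thesis
      using word_eval_eq[OF R] by (auto simp: \<theta>_def word_rel_def)
  qed
  moreover have "\<theta> \<in> hom (presented_group X R) G"
  proof (rule homI)
    fix P assume "P \<in> carrier (presented_group X R)"
    then obtain u where u: "u \<in> words X" "P = word_rel X R `` {u}"
      by (auto simp: presented_group_def quotient_def)
    then show "\<theta> P \<in> carrier G" using \<theta> word_eval_closed by simp
    fix Q assume "Q \<in> carrier (presented_group X R)"
    then obtain v where v: "v \<in> words X" "Q = word_rel X R `` {v}"
      by (auto simp: presented_group_def quotient_def)
    show "\<theta> (P \<otimes>\<^bsub>presented_group X R\<^esub> Q) = \<theta> P \<otimes> \<theta> Q"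
      using u v by (simp add: presented_group_mult \<theta> word_eval_append)
  qed
  ultimately show ?thesis by blast
qed

end

lemma left_mult_Bij: "a \<in> carrier G \<Longrightarrow> (\<lambda>x\<in>carrier G. a \<otimes> x) \<in> Bij (carrier G)"
  by (auto simp: Bij_def bij_betw_def inj_on_cmult surj_const_mult)

end

section \<open>Homomorphisms from an ascending HNN extension\<close>

locale endomorphism = group A for A (structure) +
  fixes \<phi>
  assumes \<phi>_hom: "\<phi> \<in> hom A A"
begin

abbreviation "E \<equiv> ascending_hnn A \<phi>"

definition word_class :: "('a + unit) word \<Rightarrow> ('a + unit) word set"
  where "word_class w = word_rel (carrier A <+> {()}) (hnn_relators A \<phi>) `` {w}"

definition base :: "'a \<Rightarrow> ('a + unit) word set"
  where "base a = word_class [(Inl a, True)]"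

definition stable :: "('a + unit) word set"
  where "stable = word_class [(Inr (), True)]"

sublocale E: group E
  by (rule group_ascending_hnn)

sublocale \<phi>: group_hom A A \<phi>
  using \<phi>_hom by unfold_locales

abbreviation "W \<equiv> words (carrier A <+> {()})"

lemma word_class_closed: "w \<in> W \<Longrightarrow> word_class w \<in> carrier E"
  by (auto simp: word_class_def ascending_hnn_def presented_group_def quotientI)

lemma carrier_E: "g \<in> carrier E \<Longrightarrow> \<exists>w\<in>W. g = word_class w"
  by (auto simp: word_class_def ascending_hnn_def presented_group_def quotient_def)

lemma word_class_append: "u \<in> W \<Longrightarrow> v \<in> W \<Longrightarrow> word_class (u @ v) = word_class u \<otimes>\<^bsub>E\<^esub> word_class v"
  by (simp add: word_class_def ascending_hnn_def presented_group_mult)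

lemma word_class_Nil: "word_class [] = \<one>\<^bsub>E\<^esub>"
  by (simp add: word_class_def ascending_hnn_def presented_group_def)

lemma word_class_eqI:
  "word_eq (carrier A <+> {()}) (hnn_relators A \<phi>) u v \<Longrightarrow> word_class u = word_class v"
  unfolding word_class_def by (rule equiv_class_eq[OF equiv_word_rel]) (simp add: word_rel_def)

lemma word_class_letter:
  assumes "x \<in> carrier A <+> {()}"
  shows "word_class [(x, False)] = inv\<^bsub>E\<^esub> word_class [(x, True)]"
proof -
  have w: "[(x, e)] \<in> W" for e using assms by (simp add: words_def)
  have "word_class ([(x, False)] @ [(x, True)]) = \<one>\<^bsub>E\<^esub>"
    unfolding word_class_Nil[symmetric]
    using word_eq.cancel[of "[]" _ "[]" x _ False] assms by (intro word_class_eqI) (simp add: words_def)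
  then show ?thesis
    using w word_class_closed word_class_append by (metis E.inv_equality)
qed

lemma word_class_relator:
  "r \<in> hnn_relators A \<phi> \<Longrightarrow> r \<in> W \<Longrightarrow> word_class r = \<one>\<^bsub>E\<^esub>"
  unfolding word_class_Nil[symmetric]
  using word_eq.relator[of "[]" _ "[]" r] by (intro word_class_eqI) (simp add: words_def)

lemma base_closed [simp]: "a \<in> carrier A \<Longrightarrow> base a \<in> carrier E"
  unfolding base_def by (rule word_class_closed) (auto simp: words_def)

lemma stable_closed [simp]: "stable \<in> carrier E"
  unfolding stable_def by (rule word_class_closed) (auto simp: words_def)

lemma word_class_Cons:
  assumes "(x, e) # w \<in> W"
  shows "word_class ((x, e) # w) =
    (if e then word_class [(x, True)] else inv\<^bsub>E\<^esub> word_class [(x, True)]) \<otimes>\<^bsub>E\<^esub> word_class w"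
  using assms word_class_append[of "[(x, e)]" w] word_class_letter[of x]
  by (cases e) (auto simp: words_def)

lemma base_hom: "base \<in> hom A E"
proof (rule homI)
  fix a b assume ab: "a \<in> carrier A" "b \<in> carrier A"
  let ?r = "[(Inl a, True), (Inl b, True), (Inl (a \<otimes> b), False)]"
  have r: "?r \<in> W" using ab by (auto simp: words_def)
  have "word_class ?r = \<one>\<^bsub>E\<^esub>"
    using ab r by (intro word_class_relator) (auto simp: hnn_relators_def)
  moreover have "word_class ?r = base a \<otimes>\<^bsub>E\<^esub> (base b \<otimes>\<^bsub>E\<^esub> inv\<^bsub>E\<^esub> base (a \<otimes> b))"
    using ab r by (auto simp: word_class_Cons word_class_Nil words_def base_def[symmetric])
  ultimately have "\<one>\<^bsub>E\<^esub> = base a \<otimes>\<^bsub>E\<^esub> base b \<otimes>\<^bsub>E\<^esub> inv\<^bsub>E\<^esub> base (a \<otimes> b)"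
    using ab by (simp add: E.m_assoc)
  then have "base a \<otimes>\<^bsub>E\<^esub> base b = base (a \<otimes> b)"
    using ab by (subst (asm) E.inv_solve_right) auto
  then show "base (a \<otimes> b) = base a \<otimes>\<^bsub>E\<^esub> base b" by simp
qed simp

sublocale base: group_hom A E base
  using base_hom by unfold_locales

lemma stable_base: "a \<in> carrier A \<Longrightarrow> stable \<otimes>\<^bsub>E\<^esub> base a = base (\<phi> a) \<otimes>\<^bsub>E\<^esub> stable"
proof -
  assume a: "a \<in> carrier A"
  let ?r = "[(Inr (), True), (Inl a, True), (Inr (), False), (Inl (\<phi> a), False)]"
  have r: "?r \<in> W" using a by (auto simp: words_def)
  have "word_class ?r = \<one>\<^bsub>E\<^esub>"
    using a r by (intro word_class_relator) (auto simp: hnn_relators_def)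
  moreover have "word_class ?r = stable \<otimes>\<^bsub>E\<^esub> (base a \<otimes>\<^bsub>E\<^esub> (inv\<^bsub>E\<^esub> stable \<otimes>\<^bsub>E\<^esub> inv\<^bsub>E\<^esub> base (\<phi> a)))"
    using a r by (auto simp: word_class_Cons word_class_Nil words_def base_def[symmetric] stable_def[symmetric])
  ultimately have "\<one>\<^bsub>E\<^esub> = (stable \<otimes>\<^bsub>E\<^esub> base a) \<otimes>\<^bsub>E\<^esub> inv\<^bsub>E\<^esub> (base (\<phi> a) \<otimes>\<^bsub>E\<^esub> stable)"
    using a by (simp add: E.inv_mult_group E.m_assoc)
  then show ?thesis using a by (subst (asm) E.inv_solve_right) auto
qed

section \<open>Normal forms and the universal property of the extension\<close>

lemma funpow_closed [simp]: "a \<in> carrier A \<Longrightarrow> (\<phi> ^^ m) a \<in> carrier A"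
  by (induction m) auto

lemma stable_pow_base:
  assumes "a \<in> carrier A"
  shows "stable [^]\<^bsub>E\<^esub> m \<otimes>\<^bsub>E\<^esub> base a = base ((\<phi> ^^ m) a) \<otimes>\<^bsub>E\<^esub> stable [^]\<^bsub>E\<^esub> (m::nat)"
proof (induction m)
  case (Suc m)
  have Suc2: "stable [^]\<^bsub>E\<^esub> Suc m = stable \<otimes>\<^bsub>E\<^esub> stable [^]\<^bsub>E\<^esub> m"
    by (rule E.nat_pow_Suc2) simp
  have "stable [^]\<^bsub>E\<^esub> Suc m \<otimes>\<^bsub>E\<^esub> base a = stable \<otimes>\<^bsub>E\<^esub> (stable [^]\<^bsub>E\<^esub> m \<otimes>\<^bsub>E\<^esub> base a)"
    unfolding Suc2 using assms by (simp add: E.m_assoc)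
  also have "\<dots> = (stable \<otimes>\<^bsub>E\<^esub> base ((\<phi> ^^ m) a)) \<otimes>\<^bsub>E\<^esub> stable [^]\<^bsub>E\<^esub> m"
    using assms by (simp add: Suc.IH E.m_assoc)
  also have "\<dots> = base ((\<phi> ^^ Suc m) a) \<otimes>\<^bsub>E\<^esub> stable [^]\<^bsub>E\<^esub> Suc m"
    unfolding Suc2 using assms by (simp add: stable_base E.m_assoc)
  finally show ?case .
qed (use assms in simp)

text \<open>Elements of \<open>A\<close> move past positive powers of \<open>stable\<close> from
  right to left only, so negative powers are first absorbed by a large power on the left. The
  exponent \<open>k\<close> does not depend on \<open>N\<close>; allowing all large \<open>N\<close>
  makes the induction work and lets one \<open>N\<close> serve two elements.\<close>

lemma normal_form:
  assumes "g \<in> carrier E"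
  shows "\<exists>k::int. \<exists>N0::nat. \<forall>N\<ge>N0. \<exists>a\<in>carrier A.
    stable [^]\<^bsub>E\<^esub> N \<otimes>\<^bsub>E\<^esub> g = base a \<otimes>\<^bsub>E\<^esub> stable [^]\<^bsub>E\<^esub> (k + int N)"
proof -
  obtain w where "w \<in> W" and g: "g = word_class w" using carrier_E assms by blast
  from this(1) show ?thesis unfolding g
  proof (induction w)
    case Nil
    have "stable [^]\<^bsub>E\<^esub> N \<otimes>\<^bsub>E\<^esub> \<one>\<^bsub>E\<^esub> = base \<one> \<otimes>\<^bsub>E\<^esub> stable [^]\<^bsub>E\<^esub> (0 + int N)" for N :: nat
      by (simp add: int_pow_int)
    then show ?case unfolding word_class_Nil by blast
  next
    case (Cons l w)
    obtain x e where l: "l = (x, e)" by force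
    have w: "w \<in> W" using Cons.prems by (simp add: words_def)
    define g where "g = word_class w"
    have g: "g \<in> carrier E" using w word_class_closed by (simp add: g_def)
    obtain k N0 where IH: "\<And>N. N \<ge> N0 \<Longrightarrow> \<exists>a\<in>carrier A.
        stable [^]\<^bsub>E\<^esub> (N::nat) \<otimes>\<^bsub>E\<^esub> g = base a \<otimes>\<^bsub>E\<^esub> stable [^]\<^bsub>E\<^esub> (k + int N)"
      using Cons.IH[OF w] unfolding g_def by blast
    consider (base) c where "c \<in> carrier A" "word_class (l # w) = base c \<otimes>\<^bsub>E\<^esub> g"
      | (stable) "word_class (l # w) = stable \<otimes>\<^bsub>E\<^esub> g"
      | (inv) "word_class (l # w) = inv\<^bsub>E\<^esub> stable \<otimes>\<^bsub>E\<^esub> g"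
    proof (cases x)
      case (Inl c)
      have c: "c \<in> carrier A" using Cons.prems by (auto simp: l Inl words_def)
      have "word_class (l # w) = base (if e then c else inv c) \<otimes>\<^bsub>E\<^esub> g"
        using Cons.prems c unfolding l by (simp add: word_class_Cons Inl g_def base_def[symmetric])
      then show ?thesis using c base[of "if e then c else inv c"] by (auto split: if_splits)
    next
      case (Inr u)
      then show ?thesis using Cons.prems stable inv unfolding l
        by (cases e) (auto simp: word_class_Cons g_def stable_def)
    qed
    then show ?case
    proof cases
      case base
      have "\<exists>a\<in>carrier A. stable [^]\<^bsub>E\<^esub> N \<otimes>\<^bsub>E\<^esub> word_class (l # w)
          = base a \<otimes>\<^bsub>E\<^esub> stable [^]\<^bsub>E\<^esub> (k + int N)" if N: "N \<ge> N0" for N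
      proof -
        obtain a where a: "a \<in> carrier A"
          "stable [^]\<^bsub>E\<^esub> N \<otimes>\<^bsub>E\<^esub> g = base a \<otimes>\<^bsub>E\<^esub> stable [^]\<^bsub>E\<^esub> (k + int N)" using IH[OF N] by blast
        have "stable [^]\<^bsub>E\<^esub> N \<otimes>\<^bsub>E\<^esub> (base c \<otimes>\<^bsub>E\<^esub> g) = base ((\<phi> ^^ N) c) \<otimes>\<^bsub>E\<^esub> (stable [^]\<^bsub>E\<^esub> N \<otimes>\<^bsub>E\<^esub> g)"
          using base(1) g stable_pow_base[OF base(1), of N]
          by (simp flip: E.m_assoc)
        also have "\<dots> = base ((\<phi> ^^ N) c \<otimes> a) \<otimes>\<^bsub>E\<^esub> stable [^]\<^bsub>E\<^esub> (k + int N)"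
          using base(1) a by (simp add: E.m_assoc)
        finally show ?thesis using base a(1) by (metis funpow_closed m_closed)
      qed
      then show ?thesis by blast
    next
      case stable
      have "\<exists>a\<in>carrier A. stable [^]\<^bsub>E\<^esub> N \<otimes>\<^bsub>E\<^esub> word_class (l # w)
          = base a \<otimes>\<^bsub>E\<^esub> stable [^]\<^bsub>E\<^esub> (k + 1 + int N)" if N: "N \<ge> N0" for N
      proof -
        have "stable [^]\<^bsub>E\<^esub> N \<otimes>\<^bsub>E\<^esub> (stable \<otimes>\<^bsub>E\<^esub> g) = stable [^]\<^bsub>E\<^esub> Suc N \<otimes>\<^bsub>E\<^esub> g"
          using g by (simp add: E.m_assoc)
        then show ?thesis using IH[of "Suc N"] N stable by (simp add: algebra_simps)
      qed
      then show ?thesis by blast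
    next
      case inv
      \<comment> \<open>The inverse letter uses up one power of \<open>stable\<close>, hence the
        bound \<open>Suc N0\<close> below.\<close>
      have "\<exists>a\<in>carrier A. stable [^]\<^bsub>E\<^esub> N \<otimes>\<^bsub>E\<^esub> word_class (l # w)
          = base a \<otimes>\<^bsub>E\<^esub> stable [^]\<^bsub>E\<^esub> (k - 1 + int N)" if N: "N \<ge> Suc N0" for N
      proof -
        obtain N' where N': "N = Suc N'" using N by (cases N) auto
        have "stable [^]\<^bsub>E\<^esub> N \<otimes>\<^bsub>E\<^esub> (inv\<^bsub>E\<^esub> stable \<otimes>\<^bsub>E\<^esub> g) = stable [^]\<^bsub>E\<^esub> N' \<otimes>\<^bsub>E\<^esub> g"
          using g unfolding N' by (simp add: E.m_assoc) (simp flip: E.m_assoc)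
        then show ?thesis using IH[of N'] N N' inv by (simp add: algebra_simps)
      qed
      then show ?thesis by blast
    qed
  qed
qed

lemma hom_extension:
  assumes F: "group F" and h: "h \<in> hom A F" and s: "s \<in> carrier F"
    and rel: "\<And>a. a \<in> carrier A \<Longrightarrow> s \<otimes>\<^bsub>F\<^esub> h a = h (\<phi> a) \<otimes>\<^bsub>F\<^esub> s"
  shows "\<exists>\<theta>\<in>hom E F. (\<forall>a\<in>carrier A. \<theta> (base a) = h a) \<and> \<theta> stable = s"
proof -
  interpret F: group F by fact
  interpret h: group_hom A F h using h by unfold_locales
  define k where "k = case_sum h (\<lambda>_::unit. s)"
  have k: "k \<in> carrier A <+> {()} \<rightarrow> carrier F" using s by (auto simp: k_def)
  have "word_eval F k r = \<one>\<^bsub>F\<^esub>" if "r \<in> hnn_relators A \<phi>" for r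
    using that unfolding hnn_relators_def
  proof (elim UnE CollectE exE conjE)
    fix a b
    assume "r = [(Inl a, True), (Inl b, True), (Inl (a \<otimes> b), False)]" "a \<in> carrier A" "b \<in> carrier A"
    then show ?thesis
      by (simp add: word_eval_def k_def flip: F.m_assoc)
  next
    fix a
    assume r: "r = [(Inr (), True), (Inl a, True), (Inr (), False), (Inl (\<phi> a), False)]" and a: "a \<in> carrier A"
    have "word_eval F k r = s \<otimes>\<^bsub>F\<^esub> h a \<otimes>\<^bsub>F\<^esub> inv\<^bsub>F\<^esub> (h (\<phi> a) \<otimes>\<^bsub>F\<^esub> s)"
      using a s unfolding r
      by (simp add: word_eval_def k_def F.inv_mult_group F.m_assoc)
    also have "\<dots> = \<one>\<^bsub>F\<^esub>" using rel[OF a] a s by simp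
    finally show ?thesis .
  qed
  then obtain \<theta> where \<theta>: "\<theta> \<in> hom E F" and ev: "\<And>w. w \<in> W \<Longrightarrow> \<theta> (word_class w) = word_eval F k w"
    using F.presented_group_hom[OF k, of "hnn_relators A \<phi>"]
    unfolding ascending_hnn_def word_class_def by blast
  moreover have "\<theta> (base a) = h a" if "a \<in> carrier A" for a
    unfolding base_def using that ev[of "[(Inl a, True)]"]
    by (auto simp: words_def word_eval_def k_def)
  moreover have "\<theta> stable = s"
    unfolding stable_def using s ev[of "[(Inr (), True)]"]
    by (auto simp: words_def word_eval_def k_def)
  ultimately show ?thesis by blast
qed

text \<open>Exponent sum in the stable letter modulo \<open>m\<close>. The generator is written
  \<open>1 mod int m\<close> so that it lies in the carrier for \<open>m = 1\<close> as
  well.\<close>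

lemma exponent_hom:
  "\<exists>\<theta>\<in>hom E (integer_mod_group m). (\<forall>a\<in>carrier A. \<theta> (base a) = 0) \<and> \<theta> stable = 1 mod int m"
proof -
  have "(\<lambda>_. 0) \<in> hom A (integer_mod_group m)" by (auto simp: hom_def)
  moreover have "1 mod int m \<in> carrier (integer_mod_group m)"
    by (auto simp: carrier_integer_mod_group)
  ultimately show ?thesis using hom_extension[of "integer_mod_group m"] by auto
qed

end

lemma finite_Bij: "finite S \<Longrightarrow> finite (Bij S)"
  by (rule finite_subset[OF _ finite_PiE[of S "\<lambda>_. S"]]) (auto simp: Bij_def bij_betw_def PiE_def)

section \<open>Finite quotients from invariant subgroups of finite index\<close>

locale comm_endomorphism = endomorphism + comm_group A
begin

text \<open>Translations and the map induced by \<open>\<phi>\<close> are permutations of the finite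
  set of cosets of \<open>B\<close>, and they satisfy the defining relation. A translation is
  trivial exactly when it fixes the coset \<open>B\<close>.\<close>

lemma finite_quotient_hom:
  assumes B: "subgroup B A" and fin: "finite (rcosets B)"
    and inv: "\<And>x. x \<in> carrier A \<Longrightarrow> \<phi> x \<in> B \<longleftrightarrow> x \<in> B"
  shows "\<exists>(F :: ('a set \<Rightarrow> 'a set) monoid) \<theta>. group F \<and> finite (carrier F) \<and> \<theta> \<in> hom E F \<and>
    (\<forall>x\<in>carrier A. \<theta> (base x) = \<one>\<^bsub>F\<^esub> \<longleftrightarrow> x \<in> B)"
proof -
  interpret B: normal B A using B by (rule subgroup_imp_normal)
  interpret Q: group "A Mod B" by (rule B.factorgroup_is_group)
  define S where "S = carrier (A Mod B)"
  define h where "h x = B #> \<phi> x" for x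
  have finS: "finite S" using fin by (simp add: S_def FactGroup_def)
  have cos: "B #> x \<in> S" if "x \<in> carrier A" for x using that by (auto simp: S_def carrier_FactGroup)
  have S_E: "\<exists>x\<in>carrier A. q = B #> x" if "q \<in> S" for q
    using that by (auto simp: S_def carrier_FactGroup)
  have mult: "(B #> x) \<otimes>\<^bsub>A Mod B\<^esub> (B #> y) = B #> (x \<otimes> y)" if "x \<in> carrier A" "y \<in> carrier A" for x y
    using that B.rcos_sum by simp
  have eq_iff: "B #> x = B #> y \<longleftrightarrow> x \<otimes> inv y \<in> B" if "x \<in> carrier A" "y \<in> carrier A" for x y
    using that B.rcos_module[OF is_group that(2,1)] repr_independence[OF _ that(2) B] rcos_self[OF that(1) B]
    by blast
  have h: "h \<in> hom A (A Mod B)"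
    by (rule homI) (auto simp: h_def mult cos[unfolded S_def] simp del: mult_FactGroup)
  \<comment> \<open>One direction of \<open>inv\<close> makes the induced map well defined on
    cosets, the other makes it injective.\<close>
  have h_eq: "h x = h y \<longleftrightarrow> B #> x = B #> y" if "x \<in> carrier A" "y \<in> carrier A" for x y
    using that inv[of "x \<otimes> inv y"] by (simp add: h_def eq_iff)
  obtain \<psi> where \<psi>: "\<psi> \<in> hom (A Mod B) (A Mod B)" and \<psi>_coset: "\<And>x. x \<in> carrier A \<Longrightarrow> \<psi> (B #> x) = h x"
    using FactGroup_universal[OF h B.normal_axioms] h_eq by blast
  have \<psi>_closed: "\<psi> q \<in> S" if "q \<in> S" for q using \<psi> that by (auto simp: hom_def S_def)
  have "inj_on \<psi> S" using h_eq \<psi>_coset by (auto intro!: inj_onI dest!: S_E)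
  moreover have "\<psi> ` S \<subseteq> S" using \<psi>_closed by blast
  ultimately have bij: "bij_betw \<psi> S S"
    using finS by (simp add: bij_betw_def endo_inj_surj)
  \<comment> \<open>Members of \<open>Bij S\<close> are extensional functions, hence the restriction
    to \<open>S\<close> here and in \<open>t\<close>.\<close>
  define s where "s = restrict \<psi> S"
  have s: "s \<in> Bij S" using bij by (simp add: s_def Bij_def)
  define t where "t x = (\<lambda>q\<in>S. (B #> x) \<otimes>\<^bsub>A Mod B\<^esub> q)" for x
  have t: "t x \<in> Bij S" if "x \<in> carrier A" for x
    using Q.left_mult_Bij[of "B #> x"] cos[OF that] unfolding t_def S_def by blast
  have Q_closed: "p \<otimes>\<^bsub>A Mod B\<^esub> q \<in> S" if "p \<in> S" "q \<in> S" for p q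
    using that Q.m_closed unfolding S_def by blast
  let ?F = "BijGroup S"
  have t_hom: "t \<in> hom A ?F"
  proof (rule homI)
    fix x y assume xy: "x \<in> carrier A" "y \<in> carrier A"
    have "t (x \<otimes> y) = compose S (t x) (t y)"
    proof
      fix q
      show "t (x \<otimes> y) q = compose S (t x) (t y) q"
      proof (cases "q \<in> S")
        case True
        then show ?thesis using xy cos Q_closed Q.m_assoc[of "B #> x" "B #> y" q]
          by (simp add: t_def compose_def mult[symmetric] S_def del: mult_FactGroup)
      qed (simp add: t_def compose_def)
    qed
    then show "t (x \<otimes> y) = t x \<otimes>\<^bsub>?F\<^esub> t y" using xy t by (simp add: BijGroup_def)
  qed (use t in \<open>simp add: BijGroup_def\<close>)
  have rel: "s \<otimes>\<^bsub>?F\<^esub> t x = t (\<phi> x) \<otimes>\<^bsub>?F\<^esub> s" if x: "x \<in> carrier A" for x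
  proof -
    have "compose S s (t x) = compose S (t (\<phi> x)) s"
    proof
      fix q
      show "compose S s (t x) q = compose S (t (\<phi> x)) s q"
      proof (cases "q \<in> S")
        case True
        then have "\<psi> ((B #> x) \<otimes>\<^bsub>A Mod B\<^esub> q) = (B #> \<phi> x) \<otimes>\<^bsub>A Mod B\<^esub> \<psi> q"
          using hom_mult[OF \<psi>, of "B #> x" q] cos[OF x] \<psi>_coset[OF x] by (simp add: S_def h_def)
        then show ?thesis using True x cos Q_closed \<psi>_closed
          by (simp add: t_def s_def compose_def del: mult_FactGroup)
      qed (simp add: compose_def)
    qed
    then show ?thesis using s t x by (simp add: BijGroup_def)
  qed
  obtain \<theta> where \<theta>: "\<theta> \<in> hom E ?F" "\<And>x. x \<in> carrier A \<Longrightarrow> \<theta> (base x) = t x"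
    using hom_extension[OF group_BijGroup t_hom _ rel] s by (auto simp: BijGroup_def)
  have "t x = \<one>\<^bsub>?F\<^esub> \<longleftrightarrow> x \<in> B" if x: "x \<in> carrier A" for x
  proof
    assume "t x = \<one>\<^bsub>?F\<^esub>"
    then have "t x B = B"
      using Q.one_closed by (simp add: BijGroup_def S_def)
    moreover have "t x B = B #> x"
      using Q.one_closed Q.r_one[of "B #> x"] cos[OF x] by (simp add: t_def S_def del: mult_FactGroup)
    ultimately show "x \<in> B" using coset_join1 x B by metis
  next
    assume "x \<in> B"
    then have "B #> x = \<one>\<^bsub>A Mod B\<^esub>" using coset_join2 x B by simp
    then have "t x q = (\<lambda>q\<in>S. q) q" for q
      unfolding t_def S_def by (cases "q \<in> S") (auto simp: S_def simp del: one_FactGroup mult_FactGroup)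
    then show "t x = \<one>\<^bsub>?F\<^esub>" by (auto simp: BijGroup_def)
  qed
  then show ?thesis using \<theta> group_BijGroup finite_Bij[OF finS]
    by (intro exI[of _ ?F] exI[of _ \<theta>]) (auto simp: BijGroup_def)
qed

text \<open>The preimage in \<open>A\<close> of the \<open>e\<close>-th powers of the normal closure of \<open>A\<close> in the HNN extension.\<close>

definition eventual_powers :: "nat \<Rightarrow> 'a set"
  where "eventual_powers e = {x \<in> carrier A. \<exists>m. \<exists>y\<in>carrier A. (\<phi> ^^ m) x = y [^] e}"

lemma funpow_hom: "x \<in> carrier A \<Longrightarrow> y \<in> carrier A \<Longrightarrow> (\<phi> ^^ m) (x \<otimes> y) = (\<phi> ^^ m) x \<otimes> (\<phi> ^^ m) y"
  by (induction m) auto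

lemma funpow_one [simp]: "(\<phi> ^^ m) \<one> = \<one>"
  by (induction m) auto

lemma funpow_inv: "x \<in> carrier A \<Longrightarrow> (\<phi> ^^ m) (inv x) = inv ((\<phi> ^^ m) x)"
  by (induction m) auto

lemma funpow_pow: "x \<in> carrier A \<Longrightarrow> (\<phi> ^^ m) (x [^] (e::nat)) = (\<phi> ^^ m) x [^] e"
  by (induction m) (auto simp: \<phi>.hom_nat_pow)

lemma subgroup_eventual_powers: "subgroup (eventual_powers e) A"
proof (rule subgroupI)
  show "eventual_powers e \<noteq> {}"
    unfolding eventual_powers_def by (auto intro!: exI[of _ \<one>] exI[of _ 0] bexI[of _ \<one>])
  fix x assume "x \<in> eventual_powers e"
  then obtain m y where x: "x \<in> carrier A" and y: "y \<in> carrier A" "(\<phi> ^^ m) x = y [^] e"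
    by (auto simp: eventual_powers_def)
  then have "(\<phi> ^^ m) (inv x) = (inv y) [^] e" by (simp add: funpow_inv nat_pow_inv)
  then show "inv x \<in> eventual_powers e" using x y unfolding eventual_powers_def by blast
  fix x' assume "x' \<in> eventual_powers e"
  then obtain m' y' where x': "x' \<in> carrier A" and y': "y' \<in> carrier A" "(\<phi> ^^ m') x' = y' [^] e"
    by (auto simp: eventual_powers_def)
  \<comment> \<open>Both elements are brought to the common exponent \<open>m + m'\<close>.\<close>
  have "(\<phi> ^^ (m' + m)) x = (\<phi> ^^ m') (y [^] e)" "(\<phi> ^^ (m + m')) x' = (\<phi> ^^ m) (y' [^] e)"
    by (simp_all only: funpow_add o_apply y(2) y'(2))
  then have "(\<phi> ^^ (m' + m)) (x \<otimes> x') = (\<phi> ^^ m') (y [^] e) \<otimes> (\<phi> ^^ m) (y' [^] e)"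
    using x x' by (simp add: funpow_hom add.commute)
  also have "\<dots> = ((\<phi> ^^ m') y \<otimes> (\<phi> ^^ m) y') [^] e"
    using y y' by (simp add: funpow_pow nat_pow_distrib)
  finally show "x \<otimes> x' \<in> eventual_powers e" using x x' y(1) y'(1)
    unfolding eventual_powers_def
    by (auto intro!: exI[of _ "m' + m"] bexI[of _ "(\<phi> ^^ m') y \<otimes> (\<phi> ^^ m) y'"])
qed (auto simp: eventual_powers_def)

text \<open>Passing from \<open>\<phi> x\<close> to \<open>x\<close> replaces \<open>m\<close> by
  \<open>Suc m\<close>. The \<open>e\<close>-th powers of \<open>A\<close> alone need not have this
  property, which \<open>finite_quotient_hom\<close> requires.\<close>

lemma eventual_powers_invariant:
  assumes x: "x \<in> carrier A"
  shows "\<phi> x \<in> eventual_powers e \<longleftrightarrow> x \<in> eventual_powers e"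
proof
  assume "\<phi> x \<in> eventual_powers e"
  then obtain m y where y: "y \<in> carrier A" "(\<phi> ^^ m) (\<phi> x) = y [^] e"
    by (auto simp: eventual_powers_def)
  then have "(\<phi> ^^ Suc m) x = y [^] e" by (simp add: funpow_swap1)
  then show "x \<in> eventual_powers e" using x y(1) unfolding eventual_powers_def by blast
next
  assume "x \<in> eventual_powers e"
  then obtain m y where y: "y \<in> carrier A" "(\<phi> ^^ m) x = y [^] e" by (auto simp: eventual_powers_def)
  have "(\<phi> ^^ m) (\<phi> x) = \<phi> ((\<phi> ^^ m) x)" by (simp add: funpow_swap1)
  also have "\<dots> = \<phi> y [^] e" using y by (simp add: \<phi>.hom_nat_pow)
  finally show "\<phi> x \<in> eventual_powers e"
    using x y unfolding eventual_powers_def by (auto intro!: exI[of _ m] bexI[of _ "\<phi> y"])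
qed

end

section \<open>Cyclic subgroups of an ascending HNN extension of a lattice\<close>

locale lattice_endomorphism = comm_endomorphism +
  fixes n :: nat and b :: "nat \<Rightarrow> 'a" and M :: "int mat"
  assumes basis: "Z_basis A n b" and rep: "represents A n b \<phi> M"
begin

definition elt :: "int vec \<Rightarrow> 'a"
  where "elt v = (\<Otimes>i\<in>{..<n}. b i [^] (v $ i))"

lemma M: "M \<in> carrier_mat n n"
  using rep by (simp add: represents_def)

lemma b_closed: "i < n \<Longrightarrow> b i \<in> carrier A"
  using basis by (simp add: Z_basis_def)

lemma elt_closed [simp]: "elt v \<in> carrier A"
  unfolding elt_def using b_closed by (intro finprod_closed) auto

lemma elt_add:
  assumes "v \<in> carrier_vec n" "w \<in> carrier_vec n"
  shows "elt (v + w) = elt v \<otimes> elt w"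
proof -
  have "elt (v + w) = (\<Otimes>i\<in>{..<n}. b i [^] (v $ i) \<otimes> b i [^] (w $ i))"
    unfolding elt_def using assms b_closed by (intro finprod_cong) (auto simp: int_pow_mult)
  also have "\<dots> = elt v \<otimes> elt w"
    unfolding elt_def using b_closed by (intro finprod_multf) auto
  finally show ?thesis .
qed

lemma elt_smult:
  assumes "v \<in> carrier_vec n"
  shows "elt (k \<cdot>\<^sub>v v) = elt v [^] k"
proof -
  have "elt (k \<cdot>\<^sub>v v) = (\<Otimes>i\<in>{..<n}. (b i [^] (v $ i)) [^] k)"
    unfolding elt_def using assms b_closed
    by (intro finprod_cong) (auto simp: int_pow_pow mult.commute)
  also have "\<dots> = elt v [^] k"
    unfolding elt_def using b_closed by (intro finprod_int_pow[symmetric]) auto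
  finally show ?thesis .
qed

lemma elt_0: "elt (0\<^sub>v n) = \<one>"
  unfolding elt_def by (rule finprod_one_eqI) simp

lemma elt_diff:
  assumes "v \<in> carrier_vec n" "w \<in> carrier_vec n"
  shows "elt (v - w) = elt v \<otimes> inv (elt w)"
proof -
  have "v - w = v + (-1) \<cdot>\<^sub>v w" using assms by (intro eq_vecI) auto
  then show ?thesis
    using assms elt_add elt_smult[of w "-1"] int_pow_neg[of "elt w" 1] by simp
qed

lemma basis_ex1: "x \<in> carrier A \<Longrightarrow> \<exists>!c. c \<in> ({..<n} \<rightarrow>\<^sub>E UNIV) \<and> x = (\<Otimes>i\<in>{..<n}. b i [^] (c i :: int))"
  using basis by (simp add: Z_basis_def Z_power_def integer_group_def)

lemma elt_surj: "x \<in> carrier A \<Longrightarrow> \<exists>v\<in>carrier_vec n. x = elt v"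
proof -
  assume "x \<in> carrier A"
  then obtain c where "x = (\<Otimes>i\<in>{..<n}. b i [^] (c i :: int))" using basis_ex1 by blast
  also have "\<dots> = elt (vec n c)"
    unfolding elt_def using b_closed by (intro finprod_cong) auto
  finally show ?thesis using vec_carrier by blast
qed

lemma elt_inj:
  assumes v: "v \<in> carrier_vec n" and w: "w \<in> carrier_vec n" and eq: "elt v = elt w"
  shows "v = w"
proof -
  \<comment> \<open>\<open>Z_basis\<close> gives uniqueness among extensional functions on
    \<open>{..<n}\<close>, so coordinates are restricted before being compared.\<close>
  let ?c = "\<lambda>v. restrict (($) v) {..<n}"
  have c: "elt u = (\<Otimes>i\<in>{..<n}. b i [^] ?c u i)" for u
    unfolding elt_def using b_closed by (intro finprod_cong) auto
  obtain d where d: "\<And>c'. c' \<in> {..<n} \<rightarrow>\<^sub>E UNIV \<Longrightarrow> elt v = (\<Otimes>i\<in>{..<n}. b i [^] (c' i :: int)) \<Longrightarrow> c' = d"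
    using basis_ex1[OF elt_closed, of v] by (elim ex1E) blast
  have mem: "?c u \<in> {..<n} \<rightarrow>\<^sub>E UNIV" for u by (subst restrict_PiE_iff) simp
  have "?c v = ?c w" unfolding d[OF mem c] d[OF mem HOL.trans[OF eq c]] ..
  then have "v $ i = w $ i" if "i < n" for i using that by (metis (no_types) lessThan_iff restrict_apply')
  then show ?thesis using v w by (intro eq_vecI) auto
qed

lemma elt_eq_one_iff: "v \<in> carrier_vec n \<Longrightarrow> elt v = \<one> \<longleftrightarrow> v = 0\<^sub>v n"
  using elt_inj elt_0 by (metis zero_carrier_vec)

lemma elt_\<phi>:
  assumes v: "v \<in> carrier_vec n"
  shows "\<phi> (elt v) = elt (M *\<^sub>v v)"
proof -
  \<comment> \<open>\<open>u J\<close> is the part of \<open>M *\<^sub>v v\<close> coming from the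
    first \<open>J\<close> columns.\<close>
  define u where "u J = vec n (\<lambda>i. \<Sum>j<J. M $$ (i, j) * v $ j)" for J
  have u_Suc: "u (Suc J) = u J + (v $ J) \<cdot>\<^sub>v col M J" if "J < n" for J
    using M that by (intro eq_vecI) (auto simp: u_def)
  have \<phi>b: "\<phi> (b j) = elt (col M j)" if "j < n" for j
  proof -
    have "\<phi> (b j) = (\<Otimes>i\<in>{..<n}. b i [^] (M $$ (i, j)))" using rep that by (simp add: represents_def)
    also have "\<dots> = elt (col M j)"
      unfolding elt_def using b_closed M that by (intro finprod_cong) auto
    finally show ?thesis .
  qed
  have "(\<Otimes>j\<in>{..<J}. elt (col M j) [^] (v $ j)) = elt (u J)" if "J \<le> n" for J
    using that
  proof (induction J)
    case 0
    have "u 0 = 0\<^sub>v n" by (intro eq_vecI) (auto simp: u_def)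
    then show ?case by (simp add: elt_0)
  next
    case (Suc J)
    have "elt (u (Suc J)) = elt (u J) \<otimes> elt (col M J) [^] (v $ J)"
    proof -
      have "u J \<in> carrier_vec n" "col M J \<in> carrier_vec n" using M by (auto simp: u_def)
      then show ?thesis using Suc.prems by (simp add: u_Suc elt_add elt_smult)
    qed
    then show ?case using Suc by (simp add: lessThan_Suc m_comm)
  qed
  then have "(\<Otimes>j\<in>{..<n}. elt (col M j) [^] (v $ j)) = elt (u n)" by simp
  moreover have "u n = M *\<^sub>v v"
    using M v by (intro eq_vecI) (auto simp: u_def scalar_prod_def lessThan_atLeast0)
  moreover have "\<phi> (elt v) = (\<Otimes>j\<in>{..<n}. \<phi> (b j [^] (v $ j)))"
    unfolding elt_def using b_closed
    by (intro hom_finprod[OF comm_group_axioms comm_group_axioms \<phi>_hom]) auto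
  moreover have "\<dots> = (\<Otimes>j\<in>{..<n}. elt (col M j) [^] (v $ j))"
    using b_closed by (intro finprod_cong) (auto simp: \<phi>.hom_int_pow \<phi>b)
  ultimately show ?thesis by simp
qed

lemma funpow_elt:
  assumes v: "v \<in> carrier_vec n"
  shows "(\<phi> ^^ m) (elt v) = elt (mat_poly M (monom 1 m) *\<^sub>v v)"
proof (induction m)
  case 0
  then show ?case using v by (simp add: mat_poly_1[OF M])
next
  case (Suc m)
  have "monom 1 (Suc m) = [:0, 1:] * monom (1::int) m" by (simp add: monom_Suc)
  then have "mat_poly M (monom 1 (Suc m)) *\<^sub>v v = M *\<^sub>v (mat_poly M (monom 1 m) *\<^sub>v v)"
    using mat_poly_mult_vec[OF M v] mat_poly_X[OF M] by metis
  then show ?case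
    using Suc elt_\<phi> mult_mat_vec_carrier[OF mat_poly_carrier[OF M] v] by simp
qed

text \<open>Carries the matrix results over to the group: an \<open>e\<close>-th power in
  \<open>A\<close> is a multiple of \<open>e\<close> in coordinates.\<close>

lemma elt_eventual_powers_iff:
  assumes v: "v \<in> carrier_vec n"
  shows "elt v \<in> eventual_powers e \<longleftrightarrow> eventually_dvd M (int e) v"
proof -
  have "(\<exists>y\<in>carrier A. (\<phi> ^^ m) (elt v) = y [^] e) \<longleftrightarrow> dvd_vec (int e) (mat_poly M (monom 1 m) *\<^sub>v v)" for m
  proof -
    have c: "mat_poly M (monom 1 m) *\<^sub>v v \<in> carrier_vec n"
      using mult_mat_vec_carrier[OF mat_poly_carrier[OF M] v] .
    have "(\<exists>y\<in>carrier A. (\<phi> ^^ m) (elt v) = y [^] e)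
        \<longleftrightarrow> (\<exists>w\<in>carrier_vec n. elt (mat_poly M (monom 1 m) *\<^sub>v v) = elt (int e \<cdot>\<^sub>v w))"
    proof
      assume "\<exists>y\<in>carrier A. (\<phi> ^^ m) (elt v) = y [^] e"
      then obtain w where "w \<in> carrier_vec n" "(\<phi> ^^ m) (elt v) = elt w [^] e"
        using elt_surj by blast
      then show "\<exists>w\<in>carrier_vec n. elt (mat_poly M (monom 1 m) *\<^sub>v v) = elt (int e \<cdot>\<^sub>v w)"
        by (intro bexI[of _ w]) (simp_all add: elt_smult int_pow_int flip: funpow_elt[OF v])
    next
      assume "\<exists>w\<in>carrier_vec n. elt (mat_poly M (monom 1 m) *\<^sub>v v) = elt (int e \<cdot>\<^sub>v w)"
      then obtain w where "w \<in> carrier_vec n" "(\<phi> ^^ m) (elt v) = elt w [^] e"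
        by (auto simp: elt_smult int_pow_int funpow_elt[OF v])
      then show "\<exists>y\<in>carrier A. (\<phi> ^^ m) (elt v) = y [^] e" using elt_closed by blast
    qed
    also have "\<dots> \<longleftrightarrow> dvd_vec (int e) (mat_poly M (monom 1 m) *\<^sub>v v)"
      unfolding dvd_vec_iff_smult[OF c]
      by (intro bex_cong[OF HOL.refl] iffI) (auto intro: elt_inj[OF c])
    finally show ?thesis .
  qed
  then show ?thesis by (simp add: eventual_powers_def eventually_dvd_def)
qed

text \<open>Elements with equal coordinates modulo \<open>e\<close> differ by an \<open>e\<close>-th
  power in \<open>A\<close> itself, so \<open>m = 0\<close> suffices.\<close>

lemma finite_rcosets_eventual_powers:
  assumes e: "e > 0"
  shows "finite (rcosets (eventual_powers e))"
proof (rule finite_rcosetsI[OF subgroup_eventual_powers])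
  define coords where "coords x = (SOME v. v \<in> carrier_vec n \<and> x = elt v)" for x
  have coords: "coords x \<in> carrier_vec n" "x = elt (coords x)" if "x \<in> carrier A" for x
    using someI_ex[of "\<lambda>v. v \<in> carrier_vec n \<and> x = elt v"] elt_surj[OF that]
    by (auto simp: coords_def)
  define r where "r x = (\<lambda>i\<in>{..<n}. coords x $ i mod int e)" for x
  show "finite (r ` carrier A)"
    by (rule finite_subset[OF _ finite_PiE[of "{..<n}" "\<lambda>_. {0..<int e}"]]) (use e in \<open>auto simp: r_def PiE_iff split: if_splits\<close>)
  fix x y assume x: "x \<in> carrier A" and y: "y \<in> carrier A" and "r x = r y"
  then have "coords x $ i mod int e = coords y $ i mod int e" if "i < n" for i
    using that by (metis lessThan_iff r_def restrict_apply')
  then have "dvd_vec (int e) (coords x - coords y)"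
    using coords(1)[OF x] coords(1)[OF y] by (auto simp: dvd_vec_def mod_eq_dvd_iff)
  moreover have "coords x - coords y \<in> carrier_vec n" using coords(1) x y by simp
  ultimately have "eventually_dvd M (int e) (coords x - coords y)"
    unfolding eventually_dvd_def by (intro exI[of _ 0]) (simp add: mat_poly_1[OF M])
  then have "elt (coords x - coords y) \<in> eventual_powers e"
    using elt_eventual_powers_iff coords(1) x y by simp
  then show "x \<otimes> inv y \<in> eventual_powers e"
    using elt_diff coords x y by metis
qed

lemma finite_quotient_mod_eventually_dvd:
  assumes "e > 0"
  shows "\<exists>(F :: ('a set \<Rightarrow> 'a set) monoid) \<theta>. group F \<and> finite (carrier F) \<and> \<theta> \<in> hom E F \<and>
    (\<forall>v\<in>carrier_vec n. \<theta> (base (elt v)) = \<one>\<^bsub>F\<^esub> \<longleftrightarrow> eventually_dvd M (int e) v)"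
proof -
  obtain F :: "('a set \<Rightarrow> 'a set) monoid" and \<theta> where F: "group F" "finite (carrier F)" "\<theta> \<in> hom E F"
    and \<theta>: "\<And>x. x \<in> carrier A \<Longrightarrow> \<theta> (base x) = \<one>\<^bsub>F\<^esub> \<longleftrightarrow> x \<in> eventual_powers e"
    using finite_quotient_hom[OF subgroup_eventual_powers finite_rcosets_eventual_powers[OF assms]
        eventual_powers_invariant] by blast
  have "\<theta> (base (elt v)) = \<one>\<^bsub>F\<^esub> \<longleftrightarrow> eventually_dvd M (int e) v" if "v \<in> carrier_vec n" for v
    using \<theta>[OF elt_closed] elt_eventual_powers_iff[OF that] by simp
  with F show ?thesis by blast
qed

end

section \<open>Monomorphisms: embedding of \<open>A\<close> and failure of separability\<close>

locale lattice_monomorphism = lattice_endomorphism +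
  assumes inj: "inj_on \<phi> (carrier A)"
begin

lemma det_nonzero: "det M \<noteq> 0"
proof
  assume "det M = 0"
  then obtain v where v: "v \<in> carrier_vec n" "v \<noteq> 0\<^sub>v n" "M *\<^sub>v v = 0\<^sub>v n"
    using det_0_iff_vec_prod_zero[OF M] by blast
  then have "\<phi> (elt v) = \<phi> \<one>" using elt_\<phi> elt_0 by simp
  then show False using v inj_on_eq_iff[OF inj, of "elt v" \<one>] elt_eq_one_iff by simp
qed

text \<open>\<open>A\<close> embeds in the extension. Finite quotients detecting nonzero vectors
  take the place of Britton's lemma.\<close>

lemma base_elt_eq_one_iff:
  assumes v: "v \<in> carrier_vec n"
  shows "base (elt v) = \<one>\<^bsub>E\<^esub> \<longleftrightarrow> v = 0\<^sub>v n"
proof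
  assume eq: "base (elt v) = \<one>\<^bsub>E\<^esub>"
  show "v = 0\<^sub>v n"
  proof (rule ccontr)
    assume "v \<noteq> 0\<^sub>v n"
    then obtain e where e: "e > 0" "\<not> eventually_dvd M (int e) v"
      using nonzero_not_eventually_dvd[OF M det_nonzero v] by blast
    obtain F :: "('a set \<Rightarrow> 'a set) monoid" and \<theta> where "group F" "\<theta> \<in> hom E F"
      "\<theta> (base (elt v)) = \<one>\<^bsub>F\<^esub> \<longleftrightarrow> eventually_dvd M (int e) v"
      using finite_quotient_mod_eventually_dvd[OF e(1)] v by blast
    then show False using eq e(2) hom_one[OF _ E.is_group] by metis
  qed
qed (simp add: elt_0)

text \<open>\<open>a\<close> is a \<open>p\<^sup>k\<close>-th power of a conjugate of an element of \<open>A\<close>, for every \<open>k\<close>; so if \<open>e\<close>-th powers lie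
  in \<open>K\<close>, then so does the \<open>e'\<close>-th power of \<open>a\<close>, where \<open>e'\<close> is the part prime to \<open>p\<close> of \<open>e\<close>.\<close>

lemma base_mem_finite_index:
  assumes u: "u \<in> carrier_vec n" and p: "prime p" and ev: "\<And>k. eventually_dvd M (int p ^ k) u"
    and K: "subgroup K E" "finite (rcosets\<^bsub>E\<^esub> K)" and pow: "base (elt u) [^]\<^bsub>E\<^esub> p \<in> K"
  shows "base (elt u) \<in> K"
proof -
  let ?a = "base (elt u)"
  obtain e where e: "e > 0" "\<And>g. g \<in> carrier E \<Longrightarrow> g [^]\<^bsub>E\<^esub> (e::nat) \<in> K"
    using E.finite_index_power[OF K] by blast
  obtain e' where e': "e = p ^ multiplicity p e * e'" "\<not> p dvd e'"
    using multiplicity_decompose'[of e p] e(1) p not_prime_unit by (metis not_gr_zero)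
  define k where "k = multiplicity p e"
  obtain m where m: "dvd_vec (int p ^ k) (mat_poly M (monom 1 m) *\<^sub>v u)"
    using ev by (auto simp: eventually_dvd_def)
  have "mat_poly M (monom 1 m) *\<^sub>v u \<in> carrier_vec n"
    using mult_mat_vec_carrier[OF mat_poly_carrier[OF M] u] .
  then obtain w where w: "w \<in> carrier_vec n" "mat_poly M (monom 1 m) *\<^sub>v u = int (p ^ k) \<cdot>\<^sub>v w"
    using m dvd_vec_iff_smult by auto
  define s where "s = stable [^]\<^bsub>E\<^esub> m"
  have s: "s \<in> carrier E" by (simp add: s_def)
  have sa: "s \<otimes>\<^bsub>E\<^esub> ?a = base (elt w) [^]\<^bsub>E\<^esub> int (p ^ k) \<otimes>\<^bsub>E\<^esub> s"
    using stable_pow_base[of "elt u" m] funpow_elt[OF u] w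
    by (simp add: s_def elt_smult base.hom_int_pow)
  \<comment> \<open>A conjugate of \<open>base (elt w)\<close> whose \<open>p ^ k\<close>-th power
    is \<open>?a\<close>.\<close>
  define g where "g = inv\<^bsub>E\<^esub> s \<otimes>\<^bsub>E\<^esub> base (elt w) \<otimes>\<^bsub>E\<^esub> s"
  have g: "g \<in> carrier E" using s by (simp add: g_def)
  have "g [^]\<^bsub>E\<^esub> int (p ^ k) = inv\<^bsub>E\<^esub> s \<otimes>\<^bsub>E\<^esub> (base (elt w) [^]\<^bsub>E\<^esub> int (p ^ k) \<otimes>\<^bsub>E\<^esub> s)"
    using E.conj_int_pow[of "inv\<^bsub>E\<^esub> s" "base (elt w)" "int (p ^ k)"] s
    by (simp add: g_def E.m_assoc del: of_nat_power)
  also have "\<dots> = ?a"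
    unfolding sa[symmetric] using s by (simp flip: E.m_assoc)
  finally have "?a [^]\<^bsub>E\<^esub> e' = g [^]\<^bsub>E\<^esub> e"
    using g e'(1) by (metis E.nat_pow_pow int_pow_int k_def)
  then have pow': "?a [^]\<^bsub>E\<^esub> e' \<in> K" using e(2)[OF g] by simp
  have "coprime (int p) (int e')" using e'(2) p by (simp add: prime_imp_coprime)
  \<comment> \<open>Both the \<open>p\<close>-th and the \<open>e'\<close>-th power of
    \<open>?a\<close> lie in \<open>K\<close>; Bezout recovers \<open>?a\<close>.\<close>
  then obtain x y where xy: "int p * x + int e' * y = 1"
    using bezout_int[of "int p" "int e'"] by (auto simp: mult.commute)
  have "?a = (?a [^]\<^bsub>E\<^esub> p) [^]\<^bsub>E\<^esub> x \<otimes>\<^bsub>E\<^esub> (?a [^]\<^bsub>E\<^esub> e') [^]\<^bsub>E\<^esub> y"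
    using xy E.int_pow_pow[of ?a "int p" x] E.int_pow_pow[of ?a "int e'" y]
      E.int_pow_mult[of ?a "int p * x" "int e' * y"]
    by (simp add: int_pow_int)
  also have "\<dots> \<in> K"
    using pow pow' E.subgroup_int_pow_closed[OF K(1)] subgroup.m_closed[OF K(1)] by blast
  finally show ?thesis .
qed

text \<open>The subgroup generated by the \<open>p\<close>-th power of \<open>?a\<close> is not
  separable: each finite-index subgroup containing it contains \<open>?a\<close>. But
  \<open>?a\<close> has infinite order, so it is not a power of its own \<open>p\<close>-th
  power.\<close>

theorem not_cyclic_subgroup_separable:
  assumes u: "u \<in> carrier_vec n" "u \<noteq> 0\<^sub>v n" and p: "prime p"
    and ev: "\<And>k. eventually_dvd M (int p ^ k) u"
  shows "\<not> cyclic_subgroup_separable E"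
proof
  let ?a = "base (elt u)"
  assume "cyclic_subgroup_separable E"
  then have "separable E (generate E {?a [^]\<^bsub>E\<^esub> p})"
    by (simp add: cyclic_subgroup_separable_def)
  then obtain \<K> where \<K>: "\<And>K. K \<in> \<K> \<Longrightarrow> subgroup K E \<and> finite (rcosets\<^bsub>E\<^esub> K)"
    and eq: "generate E {?a [^]\<^bsub>E\<^esub> p} = \<Inter>\<K>"
    unfolding separable_def by blast
  have "?a [^]\<^bsub>E\<^esub> p \<in> \<Inter>\<K>" unfolding eq[symmetric] by (simp add: generate.incl)
  then have "?a \<in> \<Inter>\<K>" using base_mem_finite_index[OF u(1) p ev] \<K> by blast
  then obtain i :: int where i: "?a = (?a [^]\<^bsub>E\<^esub> p) [^]\<^bsub>E\<^esub> i"
    unfolding eq[symmetric] by (auto simp: E.generate_pow)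
  then have "?a = ?a [^]\<^bsub>E\<^esub> (int p * i)"
    using E.int_pow_pow[of ?a "int p" i] by (simp add: int_pow_int)
  then have "?a [^]\<^bsub>E\<^esub> (int p * i - 1) = \<one>\<^bsub>E\<^esub>"
    using E.int_pow_diff[of ?a "int p * i" 1] by simp
  then have "base (elt ((int p * i - 1) \<cdot>\<^sub>v u)) = \<one>\<^bsub>E\<^esub>"
    using u(1) by (simp add: elt_smult base.hom_int_pow)
  then have "int p * i - 1 = 0"
    using base_elt_eq_one_iff[of "(int p * i - 1) \<cdot>\<^sub>v u"] smult_vec_eq_0_iff[OF u(1)] u by simp
  then have "int p dvd 1" by (metis diff_eq_diff_eq diff_self dvd_triv_left eq_iff_diff_eq_0)
  then show False using p by auto
qed

section \<open>Separating cyclic subgroups in finite quotients\<close>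

lemma quotient_with_exponent:
  assumes e: "e > 0" and m: "m > 0"
  obtains F :: "('a set \<Rightarrow> 'a set) monoid" and \<theta> and \<eta> where "group F" "finite (carrier F)"
    "\<theta> \<in> hom E F" "\<eta> \<in> hom E (integer_mod_group m)"
    "\<And>v. v \<in> carrier_vec n \<Longrightarrow> \<theta> (base (elt v)) = \<one>\<^bsub>F\<^esub> \<longleftrightarrow> eventually_dvd M (int e) v"
    "\<And>a k. a \<in> carrier A \<Longrightarrow> \<eta> (base a \<otimes>\<^bsub>E\<^esub> stable [^]\<^bsub>E\<^esub> (k::int)) = k mod int m"
proof -
  obtain F :: "('a set \<Rightarrow> 'a set) monoid" and \<theta> where F: "group F" "finite (carrier F)" "\<theta> \<in> hom E F"
    "\<forall>v\<in>carrier_vec n. \<theta> (base (elt v)) = \<one>\<^bsub>F\<^esub> \<longleftrightarrow> eventually_dvd M (int e) v"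
    using finite_quotient_mod_eventually_dvd[OF e] by blast
  obtain \<eta> where \<eta>: "\<eta> \<in> hom E (integer_mod_group m)" "\<forall>a\<in>carrier A. \<eta> (base a) = 0"
    "\<eta> stable = 1 mod int m"
    using exponent_hom[of m] by blast
  have "\<eta> (base a \<otimes>\<^bsub>E\<^esub> stable [^]\<^bsub>E\<^esub> k) = k mod int m" if "a \<in> carrier A" for a and k :: int
    using that \<eta> hom_mult[OF \<eta>(1), of "base a" "stable [^]\<^bsub>E\<^esub> k"]
      hom_int_pow[OF \<eta>(1) stable_closed E.is_group group_integer_mod_group, of k]
    by (simp add: int_pow_integer_mod_group mod_mult_right_eq)
  then show thesis using F \<eta>(1) that by blast
qed

text \<open>Multiplying the normal form on the right by the inverse power of \<open>stable\<close>
  turns it into a conjugate and removes \<open>N\<close> from the exponent.\<close>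

lemma normal_form_conj:
  assumes "g \<in> carrier E"
  shows "\<exists>k::int. \<exists>N0::nat. \<forall>N\<ge>N0. \<exists>v\<in>carrier_vec n.
    stable [^]\<^bsub>E\<^esub> N \<otimes>\<^bsub>E\<^esub> g \<otimes>\<^bsub>E\<^esub> inv\<^bsub>E\<^esub> (stable [^]\<^bsub>E\<^esub> N) = base (elt v) \<otimes>\<^bsub>E\<^esub> stable [^]\<^bsub>E\<^esub> k"
proof -
  obtain k :: int and N0 :: nat where nf: "\<And>N. N \<ge> N0 \<Longrightarrow> \<exists>a\<in>carrier A.
    stable [^]\<^bsub>E\<^esub> N \<otimes>\<^bsub>E\<^esub> g = base a \<otimes>\<^bsub>E\<^esub> stable [^]\<^bsub>E\<^esub> (k + int N)"
    using normal_form[OF assms] by blast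
  have "\<exists>v\<in>carrier_vec n.
    stable [^]\<^bsub>E\<^esub> N \<otimes>\<^bsub>E\<^esub> g \<otimes>\<^bsub>E\<^esub> inv\<^bsub>E\<^esub> (stable [^]\<^bsub>E\<^esub> N) = base (elt v) \<otimes>\<^bsub>E\<^esub> stable [^]\<^bsub>E\<^esub> k"
    if N: "N \<ge> N0" for N
  proof -
    obtain a where a: "a \<in> carrier A"
      "stable [^]\<^bsub>E\<^esub> N \<otimes>\<^bsub>E\<^esub> g = base a \<otimes>\<^bsub>E\<^esub> stable [^]\<^bsub>E\<^esub> (k + int N)" using nf[OF N] by blast
    obtain v where "v \<in> carrier_vec n" "a = elt v" using elt_surj[OF a(1)] by blast
    moreover have "stable [^]\<^bsub>E\<^esub> (k + int N) \<otimes>\<^bsub>E\<^esub> inv\<^bsub>E\<^esub> (stable [^]\<^bsub>E\<^esub> N) = stable [^]\<^bsub>E\<^esub> k"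
      using E.int_pow_diff[of stable "k + int N" "int N"] by (simp add: int_pow_int)
    ultimately show ?thesis using a by (auto simp: E.m_assoc)
  qed
  then show ?thesis by blast
qed

text \<open>Here the cyclic subgroup lies in \<open>A\<close>. A nonzero \<open>s\<close> is already
  seen by the exponent sum, so divisibility matters only for \<open>s = 0\<close>.\<close>

lemma separated_base_case:
  assumes ndvd: "\<And>p u. prime p \<Longrightarrow> u \<in> carrier_vec n \<Longrightarrow> u \<noteq> 0\<^sub>v n \<Longrightarrow> \<exists>k. \<not> eventually_dvd M (int p ^ k) u"
    and a: "a \<in> carrier_vec n" and c: "c \<in> carrier_vec n"
    and nmem: "\<And>i. (s::int) = 0 \<Longrightarrow> base (elt c) \<noteq> base (elt a) [^]\<^bsub>E\<^esub> (i::int)"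
  shows "\<exists>(F :: (('a set \<Rightarrow> 'a set) \<times> int) monoid) \<theta>. group F \<and> finite (carrier F) \<and> \<theta> \<in> hom E F \<and>
    (\<forall>i::int. \<theta> (base (elt c) \<otimes>\<^bsub>E\<^esub> stable [^]\<^bsub>E\<^esub> s) \<noteq> \<theta> (base (elt a)) [^]\<^bsub>F\<^esub> i)"
proof -
  define m where "m = Suc (nat \<bar>s\<bar>)"
  have "c \<noteq> i \<cdot>\<^sub>v a" if "s = 0" for i
    using nmem[OF that, of i] a by (auto simp: elt_smult base.hom_int_pow)
  then have "\<exists>e>0. s = 0 \<longrightarrow> (\<forall>i. \<not> eventually_dvd M (int e) (c - i \<cdot>\<^sub>v a))"
    using cyclic_separated_mod_eventually_dvd[OF M det_nonzero ndvd a c] by (cases "s = 0") auto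
  then obtain e where e: "e > 0" "\<And>i. s = 0 \<Longrightarrow> \<not> eventually_dvd M (int e) (c - i \<cdot>\<^sub>v a)" by blast
  have "m > 0" by (simp add: m_def)
  from quotient_with_exponent[OF e(1) this]
  obtain F :: "('a set \<Rightarrow> 'a set) monoid" and \<theta> \<eta> where F: "group F" "finite (carrier F)"
    and \<theta>: "\<theta> \<in> hom E F" and \<eta>: "\<eta> \<in> hom E (integer_mod_group m)"
    and \<theta>_1: "\<And>v. v \<in> carrier_vec n \<Longrightarrow> \<theta> (base (elt v)) = \<one>\<^bsub>F\<^esub> \<longleftrightarrow> eventually_dvd M (int e) v"
    and \<eta>_k: "\<And>a k. a \<in> carrier A \<Longrightarrow> \<eta> (base a \<otimes>\<^bsub>E\<^esub> stable [^]\<^bsub>E\<^esub> (k::int)) = k mod int m"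
    by blast
  interpret F: group F by fact
  interpret Z: group "integer_mod_group m" by simp
  interpret \<theta>: group_hom E F \<theta> using \<theta> by unfold_locales
  let ?F = "F \<times>\<times> integer_mod_group m" and ?\<theta> = "\<lambda>x. (\<theta> x, \<eta> x)"
  let ?x = "base (elt c) \<otimes>\<^bsub>E\<^esub> stable [^]\<^bsub>E\<^esub> s" and ?g = "base (elt a)"
  have "?\<theta> ?x \<noteq> ?\<theta> ?g [^]\<^bsub>?F\<^esub> i" for i :: int
  proof
    assume eq: "?\<theta> ?x = ?\<theta> ?g [^]\<^bsub>?F\<^esub> i"
    have "group ?F" by (rule DirProd_group) (auto simp: F)
    from hom_int_pow[OF hom_pair[OF \<theta> \<eta>] base_closed[OF elt_closed] E.is_group this]
    have pow: "?\<theta> (?g [^]\<^bsub>E\<^esub> i) = ?\<theta> ?g [^]\<^bsub>?F\<^esub> i" .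
    have "?\<theta> ?x = ?\<theta> (?g [^]\<^bsub>E\<^esub> i)" unfolding eq pow ..
    then have eq': "\<theta> ?x = \<theta> (?g [^]\<^bsub>E\<^esub> i)" "\<eta> ?x = \<eta> (?g [^]\<^bsub>E\<^esub> i)"
      by (simp_all only: prod.inject)
    then have "\<eta> ?x = \<eta> (base (elt (i \<cdot>\<^sub>v a)) \<otimes>\<^bsub>E\<^esub> stable [^]\<^bsub>E\<^esub> (0::int))"
      using a by (simp add: elt_smult base.hom_int_pow)
    then have "s mod int m = 0" by (simp only: \<eta>_k[OF elt_closed]) simp
    then have s: "s = 0" unfolding m_def by (rule int_mod_Suc_abs_eq_0)
    have "\<theta> (base (elt c)) = \<theta> (base (elt (i \<cdot>\<^sub>v a)))"
      using eq'(1) a s by (simp add: elt_smult base.hom_int_pow)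
    then have "\<theta> (base (elt (c - i \<cdot>\<^sub>v a))) = \<one>\<^bsub>F\<^esub>"
      using a c by (simp add: elt_diff)
    then show False using \<theta>_1 e(2)[OF s] a c by simp
  qed
  moreover have "group ?F" by (rule DirProd_group) (auto simp: F)
  moreover have "finite (carrier ?F)"
    using F(2) \<open>m > 0\<close> by (simp add: carrier_integer_mod_group)
  moreover have "?\<theta> \<in> hom E ?F" by (rule hom_pair[OF \<theta> \<eta>])
  ultimately show ?thesis by blast
qed

text \<open>If \<open>r\<close> is an exponent of the image of \<open>\<theta>\<close> and \<open>\<eta>\<close> records the exponent sum modulo \<open>k r\<close>, then the
  powers of \<open>g\<close> with exponent sum zero die in the quotient.\<close>

lemma separated_stable_case:
  assumes a: "a \<in> carrier_vec n" and c: "c \<in> carrier_vec n" and k: "k \<noteq> 0"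
    and g: "g = base (elt a) \<otimes>\<^bsub>E\<^esub> stable [^]\<^bsub>E\<^esub> (k::int)"
    and x: "x = base (elt c) \<otimes>\<^bsub>E\<^esub> stable [^]\<^bsub>E\<^esub> (s::int)"
    and nmem: "\<And>i. x \<noteq> g [^]\<^bsub>E\<^esub> (i::int)"
  shows "\<exists>(F :: (('a set \<Rightarrow> 'a set) \<times> int) monoid) \<theta>. group F \<and> finite (carrier F) \<and> \<theta> \<in> hom E F \<and>
    (\<forall>i::int. \<theta> x \<noteq> \<theta> g [^]\<^bsub>F\<^esub> i)"
proof -
  \<comment> \<open>Comparing exponent sums leaves \<open>q\<close> as the only exponent for which
    \<open>x\<close> could be a power of \<open>g\<close>; \<open>y\<close> measures the
    discrepancy.\<close>
  define q where "q = s div k"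
  have gE: "g \<in> carrier E" and xE: "x \<in> carrier E" by (simp_all add: g x)
  define y where "y = x \<otimes>\<^bsub>E\<^esub> inv\<^bsub>E\<^esub> (g [^]\<^bsub>E\<^esub> q)"
  have yE: "y \<in> carrier E" using gE xE by (simp add: y_def)
  have y1: "y \<noteq> \<one>\<^bsub>E\<^esub>"
  proof
    assume "y = \<one>\<^bsub>E\<^esub>"
    then have "\<one>\<^bsub>E\<^esub> = x \<otimes>\<^bsub>E\<^esub> inv\<^bsub>E\<^esub> (g [^]\<^bsub>E\<^esub> q)" by (simp add: y_def)
    then have "x = g [^]\<^bsub>E\<^esub> q" using gE xE by (subst (asm) E.inv_solve_right) auto
    then show False using nmem by blast
  qed
  obtain k' :: int and N :: nat where "\<forall>N'\<ge>N. \<exists>v\<in>carrier_vec n.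
    stable [^]\<^bsub>E\<^esub> N' \<otimes>\<^bsub>E\<^esub> y \<otimes>\<^bsub>E\<^esub> inv\<^bsub>E\<^esub> (stable [^]\<^bsub>E\<^esub> N') = base (elt v) \<otimes>\<^bsub>E\<^esub> stable [^]\<^bsub>E\<^esub> k'"
    using normal_form_conj[OF yE] by blast
  then obtain d where d: "d \<in> carrier_vec n"
    "stable [^]\<^bsub>E\<^esub> N \<otimes>\<^bsub>E\<^esub> y \<otimes>\<^bsub>E\<^esub> inv\<^bsub>E\<^esub> (stable [^]\<^bsub>E\<^esub> N) = base (elt d) \<otimes>\<^bsub>E\<^esub> stable [^]\<^bsub>E\<^esub> k'" by blast
  define T where "T = stable [^]\<^bsub>E\<^esub> N"
  have T: "T \<in> carrier E" by (simp add: T_def)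
  have Ty: "T \<otimes>\<^bsub>E\<^esub> y \<otimes>\<^bsub>E\<^esub> inv\<^bsub>E\<^esub> T = base (elt d) \<otimes>\<^bsub>E\<^esub> stable [^]\<^bsub>E\<^esub> k'" using d(2) by (simp add: T_def)
  \<comment> \<open>For \<open>k' \<noteq> 0\<close> any \<open>e\<close> will do, because
    \<open>k' = 0\<close> is later derived from the equation to be refuted.\<close>
  have "\<exists>e>0. k' = 0 \<longrightarrow> \<not> eventually_dvd M (int e) d"
  proof (cases "k' = 0")
    case True
    have "d \<noteq> 0\<^sub>v n"
    proof
      assume "d = 0\<^sub>v n"
      then have "\<one>\<^bsub>E\<^esub> = T \<otimes>\<^bsub>E\<^esub> y \<otimes>\<^bsub>E\<^esub> inv\<^bsub>E\<^esub> T" unfolding Ty using True by (simp add: elt_0)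
      then have "T \<otimes>\<^bsub>E\<^esub> y = T" using T yE by (subst (asm) E.inv_solve_right) auto
      then show False using y1 T yE by simp
    qed
    then show ?thesis using nonzero_not_eventually_dvd[OF M det_nonzero d(1)] by blast
  qed auto
  then obtain e where e: "e > 0" "k' = 0 \<longrightarrow> \<not> eventually_dvd M (int e) d" by (elim exE conjE)
  from finite_quotient_mod_eventually_dvd[OF e(1)]
  obtain F :: "('a set \<Rightarrow> 'a set) monoid" and \<theta> where F: "group F" "finite (carrier F)"
    and \<theta>: "\<theta> \<in> hom E F"
    and \<theta>_1: "\<And>v. v \<in> carrier_vec n \<Longrightarrow> \<theta> (base (elt v)) = \<one>\<^bsub>F\<^esub> \<longleftrightarrow> eventually_dvd M (int e) v"
    by blast
  interpret F: group F by fact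
  interpret \<theta>: group_hom E F \<theta> using \<theta> by unfold_locales
  have exponent: "\<exists>\<eta>\<in>hom E (integer_mod_group m).
      \<forall>a\<in>carrier A. \<forall>k::int. \<eta> (base a \<otimes>\<^bsub>E\<^esub> stable [^]\<^bsub>E\<^esub> k) = k mod int m" if "m > 0" for m
    by (rule quotient_with_exponent[OF e(1) that]) blast
  obtain r :: nat where r: "r > 0" and r_pow: "\<And>y. y \<in> carrier F \<Longrightarrow> y [^]\<^bsub>F\<^esub> r = \<one>\<^bsub>F\<^esub>"
    using F.finite_exponent[OF F(2)] by blast
  define m where "m = nat \<bar>k\<bar> * r"
  have m: "m > 0" "int m = \<bar>k\<bar> * int r" using r k by (simp_all add: m_def)
  obtain \<eta> where \<eta>: "\<eta> \<in> hom E (integer_mod_group m)"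
    and \<eta>_k: "\<And>a k. a \<in> carrier A \<Longrightarrow> \<eta> (base a \<otimes>\<^bsub>E\<^esub> stable [^]\<^bsub>E\<^esub> (k::int)) = k mod int m"
    using exponent[OF m(1)] by blast
  let ?F = "F \<times>\<times> integer_mod_group m" and ?\<theta> = "\<lambda>x. (\<theta> x, \<eta> x)"
  have grp: "group ?F" by (rule DirProd_group) (auto simp: F)
  have hom: "?\<theta> \<in> hom E ?F" by (rule hom_pair[OF \<theta> \<eta>])
  have "?\<theta> x \<noteq> ?\<theta> g [^]\<^bsub>?F\<^esub> i" for i :: int
  proof
    assume "?\<theta> x = ?\<theta> g [^]\<^bsub>?F\<^esub> i"
    then have eq: "?\<theta> x = ?\<theta> (g [^]\<^bsub>E\<^esub> i)"
      using hom_int_pow[OF hom gE E.is_group grp] by simp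
    have "\<eta> (g [^]\<^bsub>E\<^esub> i) = i * k mod int m"
      using hom_int_pow[OF \<eta> gE E.is_group group_integer_mod_group] \<eta>_k[OF elt_closed]
      by (simp add: g int_pow_integer_mod_group mod_mult_right_eq)
    moreover have "\<eta> x = s mod int m" using \<eta>_k[OF elt_closed] by (simp add: x)
    ultimately have "s mod int m = i * k mod int m" using eq by simp
    \<comment> \<open>The factor \<open>k\<close> makes the division defining \<open>q\<close>
      exact; the factor \<open>r\<close> gives \<open>q = i\<close> modulo \<open>r\<close>, so the
      two powers of \<open>\<theta> g\<close> agree.\<close>
    then have dvd: "\<bar>k\<bar> * int r dvd s - i * k" by (simp add: mod_eq_dvd_iff m(2))
    then have "k dvd s - i * k" using dvd_mult_left by fastforce
    then have "k dvd s" by (simp add: dvd_diff_left_iff)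
    then have s: "s = q * k" by (simp add: q_def)
    then have "s - i * k = k * (q - i)" by (simp add: algebra_simps)
    then have "\<bar>k\<bar> * int r dvd \<bar>k\<bar> * \<bar>q - i\<bar>" using dvd by (simp flip: abs_mult)
    then have "int r dvd q - i" using k by simp
    then obtain j where "q - i = int r * j" by (elim dvdE)
    then have j: "q = i + int r * j" by simp
    have pow_r: "\<theta> g [^]\<^bsub>F\<^esub> int r = \<one>\<^bsub>F\<^esub>"
      using r_pow[OF \<theta>.hom_closed[OF gE]] by (simp add: int_pow_int)
    have "\<theta> g [^]\<^bsub>F\<^esub> q = \<theta> g [^]\<^bsub>F\<^esub> i \<otimes>\<^bsub>F\<^esub> (\<theta> g [^]\<^bsub>F\<^esub> int r) [^]\<^bsub>F\<^esub> j"
      using gE j by (simp add: F.int_pow_pow flip: F.int_pow_mult)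
    then have "\<theta> g [^]\<^bsub>F\<^esub> q = \<theta> g [^]\<^bsub>F\<^esub> i" using gE by (simp add: pow_r)
    then have \<theta>y: "\<theta> y = \<one>\<^bsub>F\<^esub>"
      using eq gE xE by (simp add: y_def \<theta>.hom_int_pow)
    \<comment> \<open>Since \<open>s = q * k\<close>, the exponent sum of \<open>y\<close> is zero,
      and it is compared with \<open>k'\<close> modulo a number larger than
      \<open>\<bar>k'\<bar>\<close>.\<close>
    have k': "k' = 0"
    proof -
      let ?m = "Suc (nat \<bar>k'\<bar>)"
      obtain \<eta>' where \<eta>': "\<eta>' \<in> hom E (integer_mod_group ?m)"
        and \<eta>'_k: "\<And>a k. a \<in> carrier A \<Longrightarrow> \<eta>' (base a \<otimes>\<^bsub>E\<^esub> stable [^]\<^bsub>E\<^esub> (k::int)) = k mod int ?m"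
        using exponent[of ?m] by blast
      interpret Z: comm_group "integer_mod_group ?m" by simp
      interpret \<eta>': group_hom E "integer_mod_group ?m" \<eta>' using \<eta>' by unfold_locales
      have "\<eta>' x = s mod int ?m" "\<eta>' g = k mod int ?m" using \<eta>'_k[OF elt_closed] by (simp_all add: x g)
      then have "\<eta>' (g [^]\<^bsub>E\<^esub> q) = \<eta>' x"
        using gE by (simp add: \<eta>'.hom_int_pow int_pow_integer_mod_group mod_mult_right_eq s)
      then have "\<eta>' y = \<one>\<^bsub>integer_mod_group ?m\<^esub>"
        using gE xE unfolding y_def by (simp only: \<eta>'.hom_mult \<eta>'.hom_inv E.inv_closed E.int_pow_closed Z.r_inv \<eta>'.hom_closed)
      then have "\<eta>' (T \<otimes>\<^bsub>E\<^esub> y \<otimes>\<^bsub>E\<^esub> inv\<^bsub>E\<^esub> T) = \<one>\<^bsub>integer_mod_group ?m\<^esub>"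
        using T yE by (simp only: \<eta>'.hom_mult \<eta>'.hom_inv E.inv_closed E.m_closed Z.r_inv Z.r_one \<eta>'.hom_closed)
      then have "k' mod int ?m = 0" unfolding Ty by (simp only: \<eta>'_k[OF elt_closed] one_integer_mod_group)
      then show ?thesis by (rule int_mod_Suc_abs_eq_0)
    qed
    have "\<theta> (base (elt d)) = \<theta> (T \<otimes>\<^bsub>E\<^esub> y \<otimes>\<^bsub>E\<^esub> inv\<^bsub>E\<^esub> T)" unfolding Ty using k' by simp
    also have "\<dots> = \<one>\<^bsub>F\<^esub>" using T yE \<theta>y by simp
    finally have "\<theta> (base (elt d)) = \<one>\<^bsub>F\<^esub>" .
    then show False using \<theta>_1[OF d(1)] e(2) k' by simp
  qed
  moreover have "finite (carrier ?F)"
    using F(2) m(1) by (simp add: carrier_integer_mod_group)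
  ultimately show ?thesis using grp hom by blast
qed

text \<open>Conjugating \<open>g\<close> and \<open>x\<close> by the same power of
  \<open>stable\<close> brings both to the form \<open>base (elt v)\<close> times a power of
  \<open>stable\<close>. The exponent \<open>k\<close> belonging to \<open>g\<close> decides which
  of the two separation lemmas applies.\<close>

theorem cyclic_subgroup_separable_if_not_infinitely_dvd:
  assumes ndvd: "\<And>p u. prime p \<Longrightarrow> u \<in> carrier_vec n \<Longrightarrow> u \<noteq> 0\<^sub>v n \<Longrightarrow> \<exists>k. \<not> eventually_dvd M (int p ^ k) u"
  shows "cyclic_subgroup_separable E"
  unfolding cyclic_subgroup_separable_def
proof
  fix g assume gE: "g \<in> carrier E"
  show "separable E (generate E {g})"
  proof (rule E.separableI)
    show "subgroup (generate E {g}) E" using gE by (intro E.generate_is_subgroup) simp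
    fix x assume xE: "x \<in> carrier E" and x: "x \<notin> generate E {g}"
    obtain k N1 where nf1: "\<forall>N\<ge>N1. \<exists>v\<in>carrier_vec n.
      stable [^]\<^bsub>E\<^esub> (N::nat) \<otimes>\<^bsub>E\<^esub> g \<otimes>\<^bsub>E\<^esub> inv\<^bsub>E\<^esub> (stable [^]\<^bsub>E\<^esub> N) = base (elt v) \<otimes>\<^bsub>E\<^esub> stable [^]\<^bsub>E\<^esub> (k::int)"
      using normal_form_conj[OF gE] by blast
    obtain s N2 where nf2: "\<forall>N\<ge>N2. \<exists>v\<in>carrier_vec n.
      stable [^]\<^bsub>E\<^esub> (N::nat) \<otimes>\<^bsub>E\<^esub> x \<otimes>\<^bsub>E\<^esub> inv\<^bsub>E\<^esub> (stable [^]\<^bsub>E\<^esub> N) = base (elt v) \<otimes>\<^bsub>E\<^esub> stable [^]\<^bsub>E\<^esub> (s::int)"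
      using normal_form_conj[OF xE] by blast
    define T where "T = stable [^]\<^bsub>E\<^esub> max N1 N2"
    have T: "T \<in> carrier E" by (simp add: T_def)
    obtain a where a: "a \<in> carrier_vec n"
      and g': "T \<otimes>\<^bsub>E\<^esub> g \<otimes>\<^bsub>E\<^esub> inv\<^bsub>E\<^esub> T = base (elt a) \<otimes>\<^bsub>E\<^esub> stable [^]\<^bsub>E\<^esub> k"
      using nf1[rule_format, of "max N1 N2"] unfolding T_def by auto
    obtain c where c: "c \<in> carrier_vec n"
      and x': "T \<otimes>\<^bsub>E\<^esub> x \<otimes>\<^bsub>E\<^esub> inv\<^bsub>E\<^esub> T = base (elt c) \<otimes>\<^bsub>E\<^esub> stable [^]\<^bsub>E\<^esub> s"
      using nf2[rule_format, of "max N1 N2"] unfolding T_def by auto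
    let ?g = "T \<otimes>\<^bsub>E\<^esub> g \<otimes>\<^bsub>E\<^esub> inv\<^bsub>E\<^esub> T" and ?x = "T \<otimes>\<^bsub>E\<^esub> x \<otimes>\<^bsub>E\<^esub> inv\<^bsub>E\<^esub> T"
    have nmem: "?x \<noteq> ?g [^]\<^bsub>E\<^esub> i" for i :: int
    proof
      assume "?x = ?g [^]\<^bsub>E\<^esub> i"
      then have "x = g [^]\<^bsub>E\<^esub> i"
        using T gE xE by (simp add: E.conj_int_pow)
      then show False using x gE by (auto simp: E.generate_pow)
    qed
    have "\<exists>(F :: (('a set \<Rightarrow> 'a set) \<times> int) monoid) \<theta>. group F \<and> finite (carrier F) \<and> \<theta> \<in> hom E F \<and>
      (\<forall>i::int. \<theta> ?x \<noteq> \<theta> ?g [^]\<^bsub>F\<^esub> i)"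
    proof (cases "k = 0")
      case True
      then have g0: "?g = base (elt a)" using g' by simp
      have "base (elt c) \<noteq> base (elt a) [^]\<^bsub>E\<^esub> i" if "s = 0" for i :: int
        using nmem[of i] that unfolding g0 x' by simp
      then show ?thesis
        using separated_base_case[OF ndvd a c, of s] unfolding g0 x' by blast
    next
      case False
      then show ?thesis using separated_stable_case[OF a c False g' x'] nmem by blast
    qed
    then obtain F :: "(('a set \<Rightarrow> 'a set) \<times> int) monoid" and \<theta> where F: "group F" "finite (carrier F)"
      and \<theta>: "\<theta> \<in> hom E F" and ne: "\<And>i::int. \<theta> ?x \<noteq> \<theta> ?g [^]\<^bsub>F\<^esub> i" by blast
    interpret F: group F by fact
    interpret \<theta>: group_hom E F \<theta> using \<theta> by unfold_locales
    have "\<theta> x \<notin> generate F {\<theta> g}"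
    proof
      assume "\<theta> x \<in> generate F {\<theta> g}"
      then obtain i :: int where "\<theta> x = \<theta> g [^]\<^bsub>F\<^esub> i" using gE by (auto simp: F.generate_pow)
      then have "\<theta> ?x = \<theta> ?g [^]\<^bsub>F\<^esub> i"
        using T gE xE by (simp add: F.conj_int_pow)
      then show False using ne by blast
    qed
    then show "\<exists>K. subgroup K E \<and> finite (rcosets\<^bsub>E\<^esub> K) \<and> generate E {g} \<subseteq> K \<and> x \<notin> K"
      using E.separated_by_finite_quotient[OF F \<theta> gE xE] by blast
  qed
qed

end

theorem theorem1p1:
  fixes A :: "('a, 'm) monoid_scheme" and n l :: nat and \<phi> :: "'a \<Rightarrow> 'a"
    and b :: "nat \<Rightarrow> 'a" and M :: "int mat" and f :: "nat \<Rightarrow> int poly"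
  assumes "comm_group A" and "n \<ge> 1" and "A \<cong> Z_power n"
    and "\<phi> \<in> mon A A"
    and "Z_basis A n b" and "represents A n b \<phi> M"
    and "char_poly M = (\<Prod>i=1..l. f i)"
    and "\<And>i. i \<in> {1..l} \<Longrightarrow> lead_coeff (f i) = 1"
    and "\<And>i. i \<in> {1..l} \<Longrightarrow> irreducible (map_poly rat_of_int (f i))"
  shows "cyclic_subgroup_separable (ascending_hnn A \<phi>) \<longleftrightarrow>
    \<not> (\<exists>p i. prime p \<and> i \<in> {1..l} \<and> poly_cong (f i) (monom 1 (degree (f i))) p)"
proof -
  interpret A: comm_group A by fact
  interpret lattice_monomorphism A \<phi> n b M
    using assms(4-6) by unfold_locales (auto simp: mon_def)
  show ?thesis
  proof
    assume sep: "cyclic_subgroup_separable (ascending_hnn A \<phi>)"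
    show "\<not> (\<exists>p i. prime p \<and> i \<in> {1..l} \<and> poly_cong (f i) (monom 1 (degree (f i))) p)"
    proof clarify
      fix p i assume p: "prime p" and i: "i \<in> {1..l}" and cong: "poly_cong (f i) (monom 1 (degree (f i))) p"
      have "f i dvd char_poly M" unfolding assms(7) using i by (intro dvd_prodI) auto
      \<comment> \<open>Over the rationals a constant is zero or a unit, hence not
        irreducible.\<close>
      moreover have "degree (f i) \<noteq> 0"
        using assms(9)[OF i] by (auto simp: irreducible_def is_unit_iff_degree)
      ultimately obtain u where u: "u \<in> carrier_vec n" "u \<noteq> 0\<^sub>v n" "mat_poly M (f i) *\<^sub>v u = 0\<^sub>v n"
        using divisor_char_poly_singular[OF M] by blast
      then show False
        using not_cyclic_subgroup_separable[OF u(1,2) p eventually_dvd_power_if_cong[OF M u(1,3) cong]] sep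
        by blast
    qed
  next
    assume ncong: "\<not> (\<exists>p i. prime p \<and> i \<in> {1..l} \<and> poly_cong (f i) (monom 1 (degree (f i))) p)"
    show "cyclic_subgroup_separable (ascending_hnn A \<phi>)"
      by (rule cyclic_subgroup_separable_if_not_infinitely_dvd, rule not_infinitely_dvd[OF M _ assms(7-9)])
        (use ncong in auto)
  qed
qed

end
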